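(* The smallest order of a ring that is semicommutative, not reflexive and not duo is $16$. Moreover, up to isomorphism, the complete list of nonreflexive semicommutative nonduo rings of order $16$ is: (i) $\dfrac{\mathbb{F}_2\langle u,v\rangle}{\langle u^3,\,v^2,\,vu,\,u^2-uv\rangle}$; (ii) $\dfrac{\mathbb{Z}_4\langle u,v\rangle}{\langle u^3,\,v^2,\,vu,\,u^2-uv,\,2-uv,\,2u,\,2v\rangle}$.
   Context: All rings are associative with unity. A ring $R$ is semicommutative if for all $a,b\in R$, $ab=0$ implies $aRb=0$; reflexive if for all $a,b\in R$, $aRb=0$ implies $bRa=0$; right duo if $ba\in aR$ for all $a,b\in R$, left duo if $ba\in Rb$ for all $a,b\in R$, and duo if it is both right and left duo. For a commutative ring $A$, $A\langle u,v\rangle$ denotes the free (noncommutative) associative unital $A$-algebra on $u,v$, and $\langle\cdots\rangle$ in a denominator denotes the two-sided ideal generated by the listed elements. $\mathbb{Z}_4=\mathbb{Z}/4\mathbb{Z}$. A minimal ring of a given type is a ring of that type of smallest possible order (cardinality). *)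

theory Defs
  imports "HOL-Algebra.QuotRing" "HOL-Number_Theory.Residues"
begin

definition semicommutative_ring :: "('a, 'm) ring_scheme \<Rightarrow> bool" where
  "semicommutative_ring R \<longleftrightarrow>
     ring R \<and>
     (\<forall>a\<in>carrier R. \<forall>b\<in>carrier R. a \<otimes>\<^bsub>R\<^esub> b = \<zero>\<^bsub>R\<^esub> \<longrightarrow>
        (\<forall>r\<in>carrier R. a \<otimes>\<^bsub>R\<^esub> r \<otimes>\<^bsub>R\<^esub> b = \<zero>\<^bsub>R\<^esub>))"

definition reflexive_ring :: "('a, 'm) ring_scheme \<Rightarrow> bool" where
  "reflexive_ring R \<longleftrightarrow>
     ring R \<and>
     (\<forall>a\<in>carrier R. \<forall>b\<in>carrier R.
        (\<forall>r\<in>carrier R. a \<otimes>\<^bsub>R\<^esub> r \<otimes>\<^bsub>R\<^esub> b = \<zero>\<^bsub>R\<^esub>) \<longrightarrow>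
        (\<forall>r\<in>carrier R. b \<otimes>\<^bsub>R\<^esub> r \<otimes>\<^bsub>R\<^esub> a = \<zero>\<^bsub>R\<^esub>))"

definition right_duo_ring :: "('a, 'm) ring_scheme \<Rightarrow> bool" where
  "right_duo_ring R \<longleftrightarrow>
     ring R \<and> (\<forall>a\<in>carrier R. \<forall>b\<in>carrier R. b \<otimes>\<^bsub>R\<^esub> a \<in> a <#\<^bsub>R\<^esub> carrier R)"

definition left_duo_ring :: "('a, 'm) ring_scheme \<Rightarrow> bool" where
  "left_duo_ring R \<longleftrightarrow>
     ring R \<and> (\<forall>a\<in>carrier R. \<forall>b\<in>carrier R. b \<otimes>\<^bsub>R\<^esub> a \<in> carrier R #>\<^bsub>R\<^esub> b)"

definition duo_ring :: "('a, 'm) ring_scheme \<Rightarrow> bool" where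
  "duo_ring R \<longleftrightarrow> right_duo_ring R \<and> left_duo_ring R"

definition nonreflexive_semicommutative_nonduo :: "('a, 'm) ring_scheme \<Rightarrow> bool" where
  "nonreflexive_semicommutative_nonduo R \<longleftrightarrow>
     ring R \<and> semicommutative_ring R \<and> \<not> reflexive_ring R \<and> \<not> duo_ring R"

text \<open>The free associative unital algebra over the commutative ring \<open>A\<close> on the generators
  \<open>'x\<close>. An element is a finitely supported coefficient function on the monoid of words
  \<open>'x list\<close>; the product is convolution over the splittings of a word into a prefix and
  a suffix.\<close>

definition free_algebra :: "('a, 'm) ring_scheme \<Rightarrow> ('x list \<Rightarrow> 'a) ring" where
  "free_algebra A =
     \<lparr>carrier = {f. range f \<subseteq> carrier A \<and> finite {w. f w \<noteq> \<zero>\<^bsub>A\<^esub>}},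
      monoid.mult = (\<lambda>f g w. \<Oplus>\<^bsub>A\<^esub>i\<in>{..length w}. f (take i w) \<otimes>\<^bsub>A\<^esub> g (drop i w)),
      one = (\<lambda>w. if w = [] then \<one>\<^bsub>A\<^esub> else \<zero>\<^bsub>A\<^esub>),
      zero = (\<lambda>w. \<zero>\<^bsub>A\<^esub>),
      add = (\<lambda>f g w. f w \<oplus>\<^bsub>A\<^esub> g w)\<rparr>"

definition free_gen :: "('a, 'm) ring_scheme \<Rightarrow> 'x \<Rightarrow> 'x list \<Rightarrow> 'a" where
  "free_gen A x = (\<lambda>w. if w = [x] then \<one>\<^bsub>A\<^esub> else \<zero>\<^bsub>A\<^esub>)"

datatype gens = U | V

text \<open>In both rings below \<open>[2] \<cdot> x\<close> is the sum \<open>x \<oplus> x\<close>, and \<open>Idl\<close> is the two-sided ideal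
  generated by a set.\<close>

definition ring_i :: "(gens list \<Rightarrow> int) set ring" where
  "ring_i =
     (let A = residue_ring 2; P = free_algebra A; u = free_gen A U; v = free_gen A V
      in P Quot (Idl\<^bsub>P\<^esub>
           {u [^]\<^bsub>P\<^esub> (3::nat),
            v [^]\<^bsub>P\<^esub> (2::nat),
            v \<otimes>\<^bsub>P\<^esub> u,
            u [^]\<^bsub>P\<^esub> (2::nat) \<ominus>\<^bsub>P\<^esub> u \<otimes>\<^bsub>P\<^esub> v}))"

definition ring_ii :: "(gens list \<Rightarrow> int) set ring" where
  "ring_ii =
     (let A = residue_ring 4; P = free_algebra A; u = free_gen A U; v = free_gen A V
      in P Quot (Idl\<^bsub>P\<^esub>
           {u [^]\<^bsub>P\<^esub> (3::nat),
            v [^]\<^bsub>P\<^esub> (2::nat),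
            v \<otimes>\<^bsub>P\<^esub> u,
            u [^]\<^bsub>P\<^esub> (2::nat) \<ominus>\<^bsub>P\<^esub> u \<otimes>\<^bsub>P\<^esub> v,
            [(2::nat)] \<cdot>\<^bsub>P\<^esub> \<one>\<^bsub>P\<^esub> \<ominus>\<^bsub>P\<^esub> u \<otimes>\<^bsub>P\<^esub> v,
            [(2::nat)] \<cdot>\<^bsub>P\<^esub> u,
            [(2::nat)] \<cdot>\<^bsub>P\<^esub> v}))"

end

theory Submission
  imports Defs "HOL-Library.Z2"
begin

text \<open>In a finite semicommutative ring idempotents are central and some power of every element is
  idempotent. So if \<open>a b = 0\<close> and \<open>b a \<noteq> 0\<close>, high powers of \<open>b\<close> kill \<open>a\<close> and conversely, and
  replacing \<open>b\<close> and \<open>a\<close> by the last powers that do not yields \<open>u\<close>, \<open>v\<close> with \<open>v u = 0\<close>, \<open>s = u v \<noteq> 0\<close>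
  and \<open>u s = s v = 0\<close>. The 16 combinations of \<open>1, u, v, s\<close> with coefficients 0 and 1 are then
  distinct. If they exhaust the ring, comparing products gives \<open>2, u\<^sup>2, v\<^sup>2 \<in> {0, s}\<close>. The ring is
  duo when \<open>u\<^sup>2 = v\<^sup>2 = s\<close>; in the other cases a change of \<open>u, v\<close> achieves \<open>u\<^sup>2 = s\<close> and \<open>v\<^sup>2 = 0\<close>, and
  only the alternative \<open>2 = 0\<close> or \<open>2 = s\<close> remains.\<close>

text \<open>The explicit rings \<open>form_ring e p q\<close> serve two purposes. An abstract ring
  of order 16 is matched with one of them through its coordinates relative to \<open>u\<close> and
  \<open>v\<close>. A presented quotient is matched with one by a map out of the free algebra: the
  relations alone bound its order only from above, by a normal form, and it is the surjection onto a
  ring with 16 elements that excludes further collapse. The square of \<open>x u + y v\<close> is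
  \<open>p x^2 + x y + q y^2\<close> times \<open>s\<close>. Over two elements this quadratic form
  is anisotropic only for \<open>p = q = 1\<close>, the duo case. Otherwise a suitable isotropic
  combination can take the place of \<open>v\<close>. What survives every change of
  \<open>u\<close>, \<open>v\<close> is \<open>e\<close>, which records whether the characteristic
  is 2 or 4.\<close>

section \<open>Explicit local rings of order 16\<close>

text \<open>Polynomial identities over \<open>bit\<close> are proved by ring normalization, which the default
  rewriting of \<open>+\<close> and \<open>*\<close> to bit operations would destroy.\<close>

declare add_bit_eq_xor [simp del] mult_bit_eq_and [simp del]

type_synonym quad = "bit \<times> bit \<times> bit \<times> bit"

text \<open>The tuple \<open>(t, x, y, z)\<close> stands for \<open>t + x u + y v + z s\<close> in the local ring with residue field
  \<open>F\<^sub>2\<close> and \<open>s = u v\<close>, where \<open>v u = 0\<close>, \<open>u\<^sup>2 = p s\<close>, \<open>v\<^sup>2 = q s\<close>, \<open>1 + 1 = e s\<close>; the last relation is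
  the source of the carry in the addition.\<close>

definition form_ring :: "bit \<Rightarrow> bit \<Rightarrow> bit \<Rightarrow> quad ring" where
  "form_ring e p q =
     \<lparr>carrier = UNIV,
      monoid.mult = (\<lambda>(t, x, y, z) (t', x', y', z').
        (t * t', t * x' + x * t', t * y' + y * t',
         t * z' + z * t' + p * x * x' + x * y' + q * y * y')),
      one = (1, 0, 0, 0),
      zero = (0, 0, 0, 0),
      add = (\<lambda>(t, x, y, z) (t', x', y', z').
        (t + t', x + x', y + y', z + z' + e * t * t'))\<rparr>"

lemma form_ring_simps [simp]:
  "carrier (form_ring e p q) = UNIV"
  "(t, x, y, z) \<otimes>\<^bsub>form_ring e p q\<^esub> (t', x', y', z') =
     (t * t', t * x' + x * t', t * y' + y * t',
      t * z' + z * t' + p * x * x' + x * y' + q * y * y')"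
  "\<one>\<^bsub>form_ring e p q\<^esub> = (1, 0, 0, 0)"
  "\<zero>\<^bsub>form_ring e p q\<^esub> = (0, 0, 0, 0)"
  "(t, x, y, z) \<oplus>\<^bsub>form_ring e p q\<^esub> (t', x', y', z') =
     (t + t', x + x', y + y', z + z' + e * t * t')"
  by (simp_all add: form_ring_def)

lemma bit_self_add: "(a :: bit) + a = 0"
  by (cases a) simp_all

lemma card_quad: "card (UNIV :: quad set) = 16" "finite (UNIV :: quad set)"
proof -
  have "(UNIV :: bit set) = {0, 1}"
    using bit_not_zero_iff by blast
  moreover have "card {0, 1 :: bit} = 2"
    by simp
  ultimately have bit: "card (UNIV :: bit set) = 2" "finite (UNIV :: bit set)"
    by (metis, metis finite.emptyI finite_insert)
  then show "card (UNIV :: quad set) = 16"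
    by (simp flip: UNIV_Times_UNIV add: card_cartesian_product)
  from bit show "finite (UNIV :: quad set)"
    by (simp add: finite_Prod_UNIV)
qed

lemma ring_form_ring: "ring (form_ring e p q)"
proof (intro ringI abelian_groupI monoidI)
  fix a assume "a \<in> carrier (form_ring e p q)"
  obtain t x y z where "a = (t, x, y, z)" by (cases a)
  \<comment> \<open>From \<open>1 + 1 = e s\<close> and \<open>s + s = 0\<close> one gets
    \<open>-1 = 1 + e s\<close>, while \<open>u\<close>, \<open>v\<close>, \<open>s\<close> are
    their own negatives; hence the correction \<open>e t\<close> in the last coordinate.\<close>
  then have "(t, x, y, z + e * t) \<oplus>\<^bsub>form_ring e p q\<^esub> a = \<zero>\<^bsub>form_ring e p q\<^esub>"
    by (cases t; cases e) (simp_all add: bit_self_add)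
  then show "\<exists>b\<in>carrier (form_ring e p q). b \<oplus>\<^bsub>form_ring e p q\<^esub> a = \<zero>\<^bsub>form_ring e p q\<^esub>"
    by auto
next
  fix a b c :: quad
  obtain t x y z t' x' y' z' t'' x'' y'' z''
    where abc: "a = (t, x, y, z)" "b = (t', x', y', z')" "c = (t'', x'', y'', z'')"
    by (cases a, cases b, cases c)
  \<comment> \<open>The carries on the two sides are \<open>e t t' t''\<close> and
    \<open>e t t' t'' t''\<close>. They agree because a bit is idempotent, which ring normalization
    does not see; the split on \<open>t''\<close> supplies it.\<close>
  show "(a \<oplus>\<^bsub>form_ring e p q\<^esub> b) \<otimes>\<^bsub>form_ring e p q\<^esub> c =
      a \<otimes>\<^bsub>form_ring e p q\<^esub> c \<oplus>\<^bsub>form_ring e p q\<^esub> b \<otimes>\<^bsub>form_ring e p q\<^esub> c"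
    by (cases t''; cases e) (simp_all add: abc algebra_simps)
  show "c \<otimes>\<^bsub>form_ring e p q\<^esub> (a \<oplus>\<^bsub>form_ring e p q\<^esub> b) =
      c \<otimes>\<^bsub>form_ring e p q\<^esub> a \<oplus>\<^bsub>form_ring e p q\<^esub> c \<otimes>\<^bsub>form_ring e p q\<^esub> b"
    by (cases t''; cases e) (simp_all add: abc algebra_simps)
next
  fix a b c :: quad
  obtain t x y z t' x' y' z' t'' x'' y'' z''
    where abc: "a = (t, x, y, z)" "b = (t', x', y', z')" "c = (t'', x'', y'', z'')"
    by (cases a, cases b, cases c)
  show "a \<oplus>\<^bsub>form_ring e p q\<^esub> b \<oplus>\<^bsub>form_ring e p q\<^esub> c =
      a \<oplus>\<^bsub>form_ring e p q\<^esub> (b \<oplus>\<^bsub>form_ring e p q\<^esub> c)"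
    "a \<otimes>\<^bsub>form_ring e p q\<^esub> b \<otimes>\<^bsub>form_ring e p q\<^esub> c =
      a \<otimes>\<^bsub>form_ring e p q\<^esub> (b \<otimes>\<^bsub>form_ring e p q\<^esub> c)"
    "a \<oplus>\<^bsub>form_ring e p q\<^esub> b = b \<oplus>\<^bsub>form_ring e p q\<^esub> a"
    "\<zero>\<^bsub>form_ring e p q\<^esub> \<oplus>\<^bsub>form_ring e p q\<^esub> a = a"
    "\<one>\<^bsub>form_ring e p q\<^esub> \<otimes>\<^bsub>form_ring e p q\<^esub> a = a"
    "a \<otimes>\<^bsub>form_ring e p q\<^esub> \<one>\<^bsub>form_ring e p q\<^esub> = a"
    by (simp_all add: abc algebra_simps)
qed simp_all

text \<open>Elements with first coordinate 1 are units. For nonunits \<open>a\<close>,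
  \<open>b\<close> the product \<open>a r b\<close> equals \<open>t'' a b\<close> with
  \<open>t''\<close> the first coordinate of \<open>r\<close>, which gives semicommutativity and
  also \<open>v R u = 0\<close> in spite of \<open>u v = s\<close>. The duo property fails on the
  right: \<open>v R = {0, v}\<close> misses \<open>u v\<close>.\<close>

lemma form_ring_nonreflexive_semicommutative_nonduo:
  "nonreflexive_semicommutative_nonduo (form_ring e 1 0)"
proof -
  let ?M = "form_ring e 1 0"
  have "semicommutative_ring ?M"
    unfolding semicommutative_ring_def
  proof (intro conjI ballI impI ring_form_ring)
    fix a b r :: quad assume ab: "a \<otimes>\<^bsub>?M\<^esub> b = \<zero>\<^bsub>?M\<^esub>"
    obtain t x y z t' x' y' z' t'' x'' y'' z''
      where "a = (t, x, y, z)" "b = (t', x', y', z')" "r = (t'', x'', y'', z'')"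
      by (cases a, cases b, cases r)
    with ab show "a \<otimes>\<^bsub>?M\<^esub> r \<otimes>\<^bsub>?M\<^esub> b = \<zero>\<^bsub>?M\<^esub>"
      by (cases t; cases t'; cases x; cases t''; simp)
  qed
  moreover have "\<not> reflexive_ring ?M"
  proof
    assume "reflexive_ring ?M"
    moreover have "(0, 0, 1, 0) \<otimes>\<^bsub>?M\<^esub> r \<otimes>\<^bsub>?M\<^esub> (0, 1, 0, 0) = \<zero>\<^bsub>?M\<^esub>" for r
      by (cases r) simp
    ultimately have "(0, 1, 0, 0) \<otimes>\<^bsub>?M\<^esub> \<one>\<^bsub>?M\<^esub> \<otimes>\<^bsub>?M\<^esub> (0, 0, 1, 0) = \<zero>\<^bsub>?M\<^esub>"
      unfolding reflexive_ring_def form_ring_simps(1) by blast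
    then show False
      by simp
  qed
  moreover have "\<not> right_duo_ring ?M"
  proof
    assume "right_duo_ring ?M"
    then have "(0, 1, 0, 0) \<otimes>\<^bsub>?M\<^esub> (0, 0, 1, 0) \<in> (0, 0, 1, 0) <#\<^bsub>?M\<^esub> carrier ?M"
      unfolding right_duo_ring_def form_ring_simps(1) by blast
    then show False
      by (auto simp: l_coset_def)
  qed
  ultimately show ?thesis
    by (simp add: nonreflexive_semicommutative_nonduo_def duo_ring_def ring_form_ring)
qed

text \<open>Commutators are multiples of \<open>s\<close>, and for \<open>p = q = 1\<close> every
  nonzero one-sided ideal contains \<open>s\<close>. A change of one factor can therefore absorb the
  commutator.\<close>

lemma duo_form_ring: "duo_ring (form_ring e 1 1)"
proof -
  let ?M = "form_ring e 1 1"
  have r: "\<exists>c. b \<otimes>\<^bsub>?M\<^esub> a = a \<otimes>\<^bsub>?M\<^esub> c" and l: "\<exists>c. a \<otimes>\<^bsub>?M\<^esub> b = c \<otimes>\<^bsub>?M\<^esub> a" for a b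
  proof -
    obtain t x y z t' x' y' z' where ab: "a = (t, x, y, z)" "b = (t', x', y', z')"
      by (cases a, cases b)
    define d where "d = x * y' + y * x'"
    \<comment> \<open>Adding \<open>d s\<close>, \<open>d u\<close> or \<open>d v\<close> to
      \<open>b\<close> adds \<open>d s\<close> to the product: \<open>a s = s\<close> if
      \<open>t = 1\<close>, \<open>a u = s\<close> if \<open>t = 0\<close> and \<open>x = 1\<close>,
      \<open>a v = s\<close> if \<open>t = x = 0\<close> and \<open>y = 1\<close>. If all three
      vanish, so does \<open>d\<close>. On the other side \<open>u\<close> and \<open>v\<close>
      exchange their roles.\<close>
    have "b \<otimes>\<^bsub>?M\<^esub> a = a \<otimes>\<^bsub>?M\<^esub>
        (if t = 1 then (t', x', y', z' + d) else if x = 1 then (t', x' + d, y', z')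
         else (t', x', y' + d, z'))"
      by (cases t; cases x; cases y; cases x'; cases y') (simp_all add: ab d_def algebra_simps)
    then show "\<exists>c. b \<otimes>\<^bsub>?M\<^esub> a = a \<otimes>\<^bsub>?M\<^esub> c" ..
    have "a \<otimes>\<^bsub>?M\<^esub> b =
        (if t = 1 then (t', x', y', z' + d) else if y = 1 then (t', x', y' + d, z')
         else (t', x' + d, y', z')) \<otimes>\<^bsub>?M\<^esub> a"
      by (cases t; cases x; cases y; cases x'; cases y') (simp_all add: ab d_def algebra_simps)
    then show "\<exists>c. a \<otimes>\<^bsub>?M\<^esub> b = c \<otimes>\<^bsub>?M\<^esub> a" ..
  qed
  show ?thesis
    using r l by (auto simp: duo_ring_def right_duo_ring_def left_duo_ring_def
        l_coset_def r_coset_def ring_form_ring)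
qed

text \<open>The characteristics are 2 and 4: an isomorphism would send \<open>1 + 1\<close>, which
  is 0 on the left, to \<open>s\<close> on the right.\<close>

lemma form_ring_not_iso: "\<not> form_ring 0 p q \<simeq> form_ring 1 p' q'"
proof
  assume "form_ring 0 p q \<simeq> form_ring 1 p' q'"
  then obtain h where h: "h \<in> ring_iso (form_ring 0 p q) (form_ring 1 p' q')"
    by (auto simp: is_ring_iso_def)
  from ring_iso_memE(3)[OF h, of "(1, 0, 0, 0)" "(1, 0, 0, 0)"] ring_iso_memE(4)[OF h]
  have "h (0, 0, 0, 0) = (0, 0, 0, 1)" by (simp add: bit_self_add)
  moreover have "h (0, 0, 0, 0) = (0, 0, 0, 0)"
    using ring_hom_zero[OF _ ring_form_ring ring_form_ring, of h 0 p q 1 p' q'] h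
    by (simp add: ring_iso_def)
  ultimately show False by simp
qed

section \<open>Skew pairs in semicommutative rings\<close>

text \<open>By the pigeonhole principle the powers of \<open>a\<close> are periodic from some
  exponent \<open>i\<close> on, with a period \<open>p\<close>. If \<open>n\<close> is a multiple of
  \<open>p\<close> and at least \<open>i\<close>, then \<open>a^(n + n) = a^n\<close>.\<close>

lemma finite_monoid_idempotent_power:
  fixes G (structure)
  assumes "monoid G" "finite (carrier G)" "a \<in> carrier G"
  shows "\<exists>n > 0. a [^] (n::nat) \<otimes> a [^] n = a [^] n"
proof -
  interpret monoid G by fact
  have "\<not> inj (\<lambda>n::nat. a [^] n)"
  proof
    assume "inj (\<lambda>n::nat. a [^] n)"
    moreover have "range (\<lambda>n::nat. a [^] n) \<subseteq> carrier G"
      using assms(3) by auto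
    ultimately show False
      using assms(2) finite_subset finite_imageD infinite_UNIV_nat by metis
  qed
  then obtain i j :: nat where "i < j" and ij: "a [^] i = a [^] j"
    unfolding inj_def by (metis linorder_neqE_nat)
  define p where "p = j - i"
  have p: "p > 0" "a [^] i = a [^] (i + p)"
    using \<open>i < j\<close> ij by (simp_all add: p_def)
  have step: "a [^] (m + p) = a [^] m" if "i \<le> m" for m
  proof -
    have "a [^] (m + p) = a [^] (i + p) \<otimes> a [^] (m - i)"
      using that assms(3) by (simp add: nat_pow_mult add.commute)
    also have "\<dots> = a [^] m"
      using that assms(3) by (simp add: p(2)[symmetric] nat_pow_mult)
    finally show ?thesis .
  qed
  have periodic: "a [^] (m + k * p) = a [^] m" if "i \<le> m" for m k
    using that
  proof (induction k)
    case (Suc k)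
    have "a [^] (m + Suc k * p) = a [^] (m + k * p + p)"
      by (simp add: algebra_simps)
    with Suc step[of "m + k * p"] show ?case by simp
  qed simp
  \<comment> \<open>The factor \<open>Suc i\<close> instead of \<open>i\<close> keeps
    \<open>n\<close> positive when \<open>i = 0\<close>.\<close>
  define n where "n = Suc i * p"
  have "n > 0" "i \<le> n"
    using p(1) unfolding n_def by (simp, metis Suc_leD Suc_le_eq mult.commute mult_le_mono1 nat_mult_1 One_nat_def)
  with periodic[of n "Suc i", folded n_def] show ?thesis
    using assms(3) by (intro exI[of _ n]) (simp add: nat_pow_mult)
qed

text \<open>This selects a representative and is not a scalar action: it is additive in the bit only
  on elements with \<open>a + a = 0\<close>, and \<open>1 + 1\<close> need not vanish in
  \<open>R\<close>.\<close>

definition bit_mult :: "('a, 'm) ring_scheme \<Rightarrow> bit \<Rightarrow> 'a \<Rightarrow> 'a" where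
  "bit_mult R b a = (if b = 1 then a else \<zero>\<^bsub>R\<^esub>)"

definition bit_comb :: "('a, 'm) ring_scheme \<Rightarrow> 'a \<Rightarrow> 'a \<Rightarrow> quad \<Rightarrow> 'a" where
  "bit_comb R u v = (\<lambda>(t, x, y, z).
     bit_mult R t \<one>\<^bsub>R\<^esub> \<oplus>\<^bsub>R\<^esub> bit_mult R x u \<oplus>\<^bsub>R\<^esub> bit_mult R y v
       \<oplus>\<^bsub>R\<^esub> bit_mult R z (u \<otimes>\<^bsub>R\<^esub> v))"

context ring
begin

lemma bit_mult_simps [simp]:
  "bit_mult R 0 a = \<zero>" "bit_mult R 1 a = a" "bit_mult R b \<zero> = \<zero>"
  by (simp_all add: bit_mult_def)

lemma bit_mult_closed [simp, intro]: "a \<in> carrier R \<Longrightarrow> bit_mult R b a \<in> carrier R"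
  by (simp add: bit_mult_def)

lemma bit_mult_mult:
  assumes "a \<in> carrier R" "a' \<in> carrier R"
  shows "bit_mult R b a \<otimes> bit_mult R b' a' = bit_mult R (b * b') (a \<otimes> a')"
  using assms by (cases b; cases b') simp_all

lemma bit_mult_right:
  "a \<in> carrier R \<Longrightarrow> c \<in> carrier R \<Longrightarrow> bit_mult R b a \<otimes> c = bit_mult R b (a \<otimes> c)"
  "a \<in> carrier R \<Longrightarrow> c \<in> carrier R \<Longrightarrow> c \<otimes> bit_mult R b a = bit_mult R b (c \<otimes> a)"
  by (cases b; simp)+

lemma bit_mult_add:
  assumes "a \<in> carrier R" "a \<oplus> a = \<zero>"
  shows "bit_mult R (b + b') a = bit_mult R b a \<oplus> bit_mult R b' a"
  using assms by (cases b; cases b') (simp_all add: bit_self_add)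

lemma bit_mult_bit_mult: "bit_mult R b (bit_mult R b' a) = bit_mult R (b * b') a"
  by (cases b; cases b') simp_all

lemma bit_mult_inject: "a \<noteq> \<zero> \<Longrightarrow> bit_mult R b a = bit_mult R b' a \<longleftrightarrow> b = b'"
  by (cases b; cases b') auto

lemma bit_mult_eq_zero:
  assumes "a \<noteq> \<zero>"
  shows "bit_mult R b a = \<zero> \<longleftrightarrow> b = 0" "\<zero> = bit_mult R b a \<longleftrightarrow> b = 0"
  using assms by (cases b; auto)+

end

text \<open>Multiplying a combination \<open>t + x u + y v + z u v\<close> (all coefficients 0 or 1) by \<open>u v\<close>, then by \<open>v\<close> from
  the right and the left, then by \<open>u\<close> from the left recovers \<open>t\<close>, \<open>x\<close> and \<open>y\<close> in turn, so the
  16 combinations are distinct.\<close>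

locale skew_pair = ring +
  fixes u v
  assumes u [simp, intro]: "u \<in> carrier R" and v [simp, intro]: "v \<in> carrier R"
    and vu: "v \<otimes> u = \<zero>" and uv: "u \<otimes> v \<noteq> \<zero>"
    and uuv: "u \<otimes> (u \<otimes> v) = \<zero>" and uvv: "u \<otimes> v \<otimes> v = \<zero>"
begin

abbreviation s where "s \<equiv> u \<otimes> v"

lemma bit_comb_closed [simp, intro]: "bit_comb R u v a \<in> carrier R"
  by (cases a) (simp add: bit_comb_def)

lemma s_mult [simp]:
  "v \<otimes> u = \<zero>" "u \<otimes> s = \<zero>" "s \<otimes> v = \<zero>" "v \<otimes> s = \<zero>" "s \<otimes> u = \<zero>" "s \<otimes> s = \<zero>"
proof -
  show vs: "v \<otimes> s = \<zero>" by (simp add: vu flip: m_assoc)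
  show "s \<otimes> u = \<zero>" by (simp add: vu m_assoc)
  show "s \<otimes> s = \<zero>" by (simp add: vs m_assoc)
qed (fact vu uuv uvv)+

lemma bit_comb_mult:
  "bit_comb R u v (t, x, y, z) \<otimes> s = bit_mult R t s"
  "s \<otimes> bit_comb R u v (t, x, y, z) = bit_mult R t s"
  "bit_comb R u v (t, x, y, z) \<otimes> u = bit_mult R t u \<oplus> bit_mult R x (u \<otimes> u)"
  "v \<otimes> bit_comb R u v (t, x, y, z) = bit_mult R t v \<oplus> bit_mult R y (v \<otimes> v)"
  "u \<otimes> bit_comb R u v (t, x, y, z) =
     bit_mult R t u \<oplus> bit_mult R x (u \<otimes> u) \<oplus> bit_mult R y s"
  "bit_comb R u v (t, x, y, z) \<otimes> v =
     bit_mult R t v \<oplus> bit_mult R x s \<oplus> bit_mult R y (v \<otimes> v)"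
  by (simp_all add: bit_comb_def l_distr r_distr bit_mult_right a_assoc)

lemma bit_comb_inj: "inj (bit_comb R u v)"
proof (rule injI)
  fix a b
  assume eq: "bit_comb R u v a = bit_comb R u v b"
  obtain t x y z t' x' y' z' where ab: "a = (t, x, y, z)" "b = (t', x', y', z')"
    by (cases a, cases b)
  have "bit_comb R u v a \<otimes> s = bit_comb R u v b \<otimes> s"
    by (simp add: eq)
  then have t: "t = t'"
    by (simp add: ab bit_comb_mult bit_mult_inject uv)
  \<comment> \<open>Nothing is known yet about \<open>u u\<close> and \<open>v v\<close>, so the
    order matters. The first product fixes the term in \<open>v v\<close>, which then cancels in the
    third and leaves \<open>x\<close>; with \<open>x\<close> known the term in \<open>u u\<close>
    cancels in the second and leaves \<open>y\<close>.\<close>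
  have "v \<otimes> bit_comb R u v a = v \<otimes> bit_comb R u v b"
    "u \<otimes> bit_comb R u v a = u \<otimes> bit_comb R u v b"
    "bit_comb R u v a \<otimes> v = bit_comb R u v b \<otimes> v"
    by (simp_all add: eq)
  then have vv: "bit_mult R y (v \<otimes> v) = bit_mult R y' (v \<otimes> v)"
    and *: "bit_mult R x (u \<otimes> u) \<oplus> bit_mult R y s = bit_mult R x' (u \<otimes> u) \<oplus> bit_mult R y' s"
    and **: "bit_mult R x s \<oplus> bit_mult R y (v \<otimes> v) = bit_mult R x' s \<oplus> bit_mult R y' (v \<otimes> v)"
    by (simp_all add: ab bit_comb_mult t a_assoc)
  from ** vv have x: "x = x'"
    by (simp add: bit_mult_inject uv)
  with * have y: "y = y'"
    by (simp add: bit_mult_inject uv)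
  with eq t x have "bit_mult R z s = bit_mult R z' s"
    by (simp add: ab bit_comb_def)
  then have "z = z'"
    by (simp add: bit_mult_inject uv)
  with t x y show "a = b" by (simp add: ab)
qed

lemma order_ge: "finite (carrier R) \<Longrightarrow> 16 \<le> order R"
  using card_inj_on_le[OF bit_comb_inj, of "carrier R"] card_quad
  by (auto simp: order_def)

lemma bit_comb_range:
  assumes "order R = 16"
  shows "range (bit_comb R u v) = carrier R"
proof (rule card_subset_eq)
  show "finite (carrier R)"
    using assms by (auto simp: order_def intro: card_ge_0_finite)
  show "card (range (bit_comb R u v)) = card (carrier R)"
    using assms card_image[OF bit_comb_inj] card_quad by (simp add: order_def)
qed auto

lemma structure_constants:
  assumes "order R = 16"
  obtains e p q where "\<one> \<oplus> \<one> = bit_mult R e s" "u \<otimes> u = bit_mult R p s"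
    "v \<otimes> v = bit_mult R q s" "s \<oplus> s = \<zero>"
proof -
  have repr: "\<exists>t x y z. a = bit_comb R u v (t, x, y, z)" if "a \<in> carrier R" for a
    using that bit_comb_range[OF assms] by (metis imageE prod_cases4)
  obtain t x y z where two: "\<one> \<oplus> \<one> = bit_comb R u v (t, x, y, z)"
    using repr by blast
  have "s \<oplus> s = (\<one> \<oplus> \<one>) \<otimes> s"
    by (simp add: l_distr)
  also have "\<dots> = bit_mult R t s"
    unfolding two by (rule bit_comb_mult)
  finally have ss: "s \<oplus> s = bit_mult R t s" .
  have "t \<noteq> 1"
  proof
    assume "t = 1"
    then have "s \<oplus> s = s" using ss by simp
    then show False using uv by simp
  qed
  then have t: "t = 0" by simp
  \<comment> \<open>Since \<open>1 + 1\<close> is central, its commutators with \<open>v\<close> and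
    with \<open>u\<close> vanish. The squares cancel in them, and what remains is \<open>x s\<close>
    and \<open>y s\<close> respectively.\<close>
  have "(\<one> \<oplus> \<one>) \<otimes> v = v \<otimes> (\<one> \<oplus> \<one>)" "(\<one> \<oplus> \<one>) \<otimes> u = u \<otimes> (\<one> \<oplus> \<one>)"
    by (simp_all add: l_distr r_distr)
  then have "x = 0" "y = 0"
    unfolding two bit_comb_mult t by (simp_all add: bit_mult_eq_zero uv)
  then have e: "\<one> \<oplus> \<one> = bit_mult R z s"
    using two t by (simp add: bit_comb_def)
  obtain t' x' y' z' where uu: "u \<otimes> u = bit_comb R u v (t', x', y', z')"
    using repr by blast
  \<comment> \<open>The first identity gives \<open>t' = 0\<close>. The second removes the unknown
    term \<open>y' v v\<close> from the third, which becomes \<open>x' s = 0\<close>. In the last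
    one \<open>x' u u\<close> cancels and \<open>y' s = 0\<close> remains.\<close>
  have "u \<otimes> u \<otimes> s = \<zero>" "v \<otimes> (u \<otimes> u) = \<zero>" "u \<otimes> u \<otimes> v = \<zero>"
    "u \<otimes> u \<otimes> u = u \<otimes> (u \<otimes> u)"
    by (simp add: m_assoc, simp flip: m_assoc, simp_all add: m_assoc)
  note this[unfolded uu]
  then have t': "t' = 0" and "bit_mult R y' (v \<otimes> v) = \<zero>" "bit_mult R x' s = \<zero>"
    and "bit_mult R y' s = \<zero>"
    by (simp_all add: bit_comb_mult bit_mult_eq_zero uv)
  then have "x' = 0" "y' = 0"
    by (simp_all add: bit_mult_eq_zero uv)
  with t' have p: "u \<otimes> u = bit_mult R z' s"
    using uu by (simp add: bit_comb_def)
  obtain t'' x'' y'' z'' where vv: "v \<otimes> v = bit_comb R u v (t'', x'', y'', z'')"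
    using repr by blast
  \<comment> \<open>The mirror image: the third identity removes \<open>x'' u u\<close> from the
    second, and \<open>y'' v v\<close> cancels in the last.\<close>
  have "v \<otimes> v \<otimes> s = \<zero>" "u \<otimes> (v \<otimes> v) = \<zero>" "v \<otimes> v \<otimes> u = \<zero>"
    "v \<otimes> v \<otimes> v = v \<otimes> (v \<otimes> v)"
    by (simp add: m_assoc, simp flip: m_assoc, simp_all add: m_assoc)
  note this[unfolded vv]
  then have t'': "t'' = 0" and "bit_mult R x'' s = \<zero>" "bit_mult R y'' s = \<zero>"
    by (simp_all add: bit_comb_mult bit_mult_eq_zero uv)
  then have "x'' = 0" "y'' = 0"
    by (simp_all add: bit_mult_eq_zero uv)
  with t'' have "v \<otimes> v = bit_mult R z'' s"
    using vv by (simp add: bit_comb_def)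
  with e p ss t that show ?thesis by simp
qed

text \<open>From \<open>1 + 1 = e s\<close> and \<open>s u = s v = 0\<close> it follows that
  \<open>u + u = v + v = 0\<close>. Hence adding two combinations produces a carry only at the
  coefficient of 1, and that carry is the term \<open>e t t'\<close> of
  \<open>form_ring\<close>.\<close>

lemma iso_form_ring:
  assumes "order R = 16" "\<one> \<oplus> \<one> = bit_mult R e s" "u \<otimes> u = bit_mult R p s"
    "v \<otimes> v = bit_mult R q s" "s \<oplus> s = \<zero>"
  shows "R \<simeq> form_ring e p q"
proof -
  have two: "a \<oplus> a = bit_mult R e (s \<otimes> a)" if "a \<in> carrier R" for a
  proof -
    have "a \<oplus> a = (\<one> \<oplus> \<one>) \<otimes> a"
      using that by (simp add: l_distr)
    then show ?thesis
      using that by (simp add: assms bit_mult_right)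
  qed
  have uu: "u \<oplus> u = \<zero>" and vv: "v \<oplus> v = \<zero>"
    by (simp_all add: two)
  have one: "bit_mult R (t + t') \<one> \<oplus> bit_mult R (e * t * t') s
      = bit_mult R t \<one> \<oplus> bit_mult R t' \<one>" for t t'
    by (cases t; cases t') (simp_all add: assms bit_self_add)
  have "bit_comb R u v \<in> ring_iso (form_ring e p q) R"
  proof (rule ring_iso_memI)
    fix a b :: quad
    obtain t x y z t' x' y' z' where ab: "a = (t, x, y, z)" "b = (t', x', y', z')"
      by (cases a, cases b)
    have "bit_comb R u v (a \<oplus>\<^bsub>form_ring e p q\<^esub> b) =
        (bit_mult R (t + t') \<one> \<oplus> bit_mult R (e * t * t') s) \<oplus> bit_mult R (x + x') u
        \<oplus> bit_mult R (y + y') v \<oplus> (bit_mult R z s \<oplus> bit_mult R z' s)"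
      by (simp add: ab bit_comb_def bit_mult_add assms a_ac)
    also have "\<dots> = bit_comb R u v a \<oplus> bit_comb R u v b"
      unfolding one by (simp add: ab bit_comb_def bit_mult_add uu vv a_ac)
    finally show "bit_comb R u v (a \<oplus>\<^bsub>form_ring e p q\<^esub> b) = bit_comb R u v a \<oplus> bit_comb R u v b" .
    have rows: "bit_mult R t \<one> \<otimes> bit_comb R u v b = bit_mult R (t * t') \<one>
        \<oplus> bit_mult R (t * x') u \<oplus> bit_mult R (t * y') v \<oplus> bit_mult R (t * z') s"
      "bit_mult R x u \<otimes> bit_comb R u v b = bit_mult R (x * t') u
        \<oplus> bit_mult R (p * x * x') s \<oplus> bit_mult R (x * y') s"
      "bit_mult R y v \<otimes> bit_comb R u v b = bit_mult R (y * t') v \<oplus> bit_mult R (q * y * y') s"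
      "bit_mult R z s \<otimes> bit_comb R u v b = bit_mult R (z * t') s"
      by (simp_all add: ab bit_comb_def r_distr bit_mult_mult assms(3,4) bit_mult_bit_mult mult_ac)
    have rearrange: "(a1 \<oplus> a2 \<oplus> a3 \<oplus> a4) \<oplus> (b1 \<oplus> b2 \<oplus> b3) \<oplus> (c1 \<oplus> c2) \<oplus> d1 =
        a1 \<oplus> (a2 \<oplus> b1) \<oplus> (a3 \<oplus> c1) \<oplus> (a4 \<oplus> d1 \<oplus> b2 \<oplus> b3 \<oplus> c2)"
      if "{a1, a2, a3, a4, b1, b2, b3, c1, c2, d1} \<subseteq> carrier R"
      for a1 a2 a3 a4 b1 b2 b3 c1 c2 d1
      using that by (simp add: a_ac)
    have "bit_comb R u v a \<otimes> bit_comb R u v b =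
        bit_mult R t \<one> \<otimes> bit_comb R u v b \<oplus> bit_mult R x u \<otimes> bit_comb R u v b \<oplus>
        bit_mult R y v \<otimes> bit_comb R u v b \<oplus> bit_mult R z s \<otimes> bit_comb R u v b"
      unfolding ab(1) by (subst bit_comb_def) (simp add: l_distr)
    also have "\<dots> = bit_comb R u v (a \<otimes>\<^bsub>form_ring e p q\<^esub> b)"
      unfolding rows
      by (subst rearrange) (simp_all add: ab bit_comb_def bit_mult_add uu vv assms(5))
    finally show "bit_comb R u v (a \<otimes>\<^bsub>form_ring e p q\<^esub> b) = bit_comb R u v a \<otimes> bit_comb R u v b"
      by (rule sym)
  next
    show "bij_betw (bit_comb R u v) (carrier (form_ring e p q)) (carrier R)"
      using bit_comb_inj bit_comb_range[OF assms(1)] by (simp add: bij_betw_def)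
  qed (rule bit_comb_closed, simp add: bit_comb_def)
  then have "form_ring e p q \<simeq> R"
    by (auto simp: is_ring_iso_def)
  then show ?thesis
    by (rule ring_iso_sym[OF ring_form_ring])
qed

end

section \<open>Existence of a skew pair in a finite nonreflexive semicommutative ring\<close>

context ring
begin

lemma semicommutativeD:
  assumes "semicommutative_ring R" "a \<in> carrier R" "b \<in> carrier R" "a \<otimes> b = \<zero>" "r \<in> carrier R"
  shows "a \<otimes> r \<otimes> b = \<zero>"
  using assms unfolding semicommutative_ring_def by blast

text \<open>Both products of \<open>e\<close> and \<open>1 - e\<close> vanish, and inserting
  \<open>r\<close> between the factors gives \<open>e r = e r e = r e\<close>.\<close>

lemma semicommutative_idempotent_central:
  assumes R: "semicommutative_ring R" and e: "e \<in> carrier R" "e \<otimes> e = e" and r: "r \<in> carrier R"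
  shows "e \<otimes> r = r \<otimes> e"
proof -
  have "e \<otimes> (\<one> \<ominus> e) = \<zero>" "(\<one> \<ominus> e) \<otimes> e = \<zero>"
    using e by (simp_all add: minus_eq r_distr l_distr r_minus l_minus r_neg)
  then have "e \<otimes> r \<otimes> (\<one> \<ominus> e) = \<zero>" "(\<one> \<ominus> e) \<otimes> r \<otimes> e = \<zero>"
    using semicommutativeD[OF R] e r by simp_all
  then have "e \<otimes> r \<ominus> e \<otimes> r \<otimes> e = \<zero>" "r \<otimes> e \<ominus> e \<otimes> r \<otimes> e = \<zero>"
    using e r by (simp_all add: minus_eq r_distr l_distr r_minus l_minus m_assoc)
  then show ?thesis
    using e r by (metis m_closed minus_equality minus_minus r_right_minus_eq)
qed

text \<open>Some power of \<open>b\<close> (of \<open>a\<close>) is an idempotent, hence central.\<close>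

lemma semicommutative_annihilating_power:
  assumes R: "semicommutative_ring R" "finite (carrier R)"
    and ab: "a \<in> carrier R" "b \<in> carrier R" "a \<otimes> b = \<zero>"
  shows "\<exists>n::nat. b [^] n \<otimes> a = \<zero>" "\<exists>n::nat. b \<otimes> a [^] n = \<zero>"
proof -
  obtain n :: nat where n: "n > 0" "b [^] n \<otimes> b [^] n = b [^] n"
    using finite_monoid_idempotent_power[OF monoid_axioms R(2) ab(2)] by blast
  have "b [^] n = b \<otimes> b [^] (n - 1)"
    using n(1) nat_pow_Suc2[OF ab(2), of "n - 1"] by simp
  then have "a \<otimes> b [^] n = \<zero>"
    using ab by (simp flip: m_assoc)
  then show "\<exists>n::nat. b [^] n \<otimes> a = \<zero>"
    using semicommutative_idempotent_central[OF R(1) _ n(2) ab(1)] ab by auto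
  obtain n :: nat where n: "n > 0" "a [^] n \<otimes> a [^] n = a [^] n"
    using finite_monoid_idempotent_power[OF monoid_axioms R(2) ab(1)] by blast
  have "a [^] n = a [^] (n - 1) \<otimes> a"
    using n(1) nat_pow_Suc[of a "n - 1"] by simp
  then have "a [^] n \<otimes> b = \<zero>"
    using ab by (simp add: m_assoc)
  then show "\<exists>n::nat. b \<otimes> a [^] n = \<zero>"
    using semicommutative_idempotent_central[OF R(1) _ n(2) ab(2)] ab by auto
qed

text \<open>If \<open>n\<close> is the least exponent with \<open>b^n c = 0\<close>, where
  \<open>b c\<close> is nonzero, then \<open>n\<close> is at least 2. So
  \<open>u = b^(n - 1)\<close> satisfies \<open>u c \<noteq> 0\<close>, and \<open>u u c = 0\<close>
  because \<open>2 (n - 1) \<ge> n\<close>. The same device applied to the powers of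
  \<open>c\<close> gives \<open>v\<close>.\<close>

lemma finite_nonreflexive_semicommutative_skew_pair:
  assumes R: "semicommutative_ring R" "\<not> reflexive_ring R" "finite (carrier R)"
  shows "\<exists>u v. skew_pair R u v"
proof -
  obtain a b r where ab: "a \<in> carrier R" "b \<in> carrier R" "r \<in> carrier R"
    "b \<otimes> r \<otimes> a \<noteq> \<zero>" "\<forall>r\<in>carrier R. a \<otimes> r \<otimes> b = \<zero>"
    using R(2) ring_axioms unfolding reflexive_ring_def by blast
  define c where "c = r \<otimes> a"
  \<comment> \<open>Moving \<open>r\<close> into the second factor turns the failure of reflexivity
    into a pair with \<open>c b = 0\<close> and \<open>b c \<noteq> 0\<close>.\<close>
  have c: "c \<in> carrier R" "b \<otimes> c \<noteq> \<zero>" "c \<otimes> b = \<zero>"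
    using ab bspec[OF ab(5) one_closed] by (simp_all add: c_def m_assoc)
  obtain n :: nat where "b [^] n \<otimes> c = \<zero>" "\<And>m. m < n \<Longrightarrow> b [^] m \<otimes> c \<noteq> \<zero>"
    using exists_least_iff[of "\<lambda>n::nat. b [^] n \<otimes> c = \<zero>"]
      semicommutative_annihilating_power(1)[OF R(1,3) c(1) ab(2) c(3)] by blast
  note n = this
  have "n \<noteq> 0" "n \<noteq> 1"
    using n(1) c ab by (metis l_one nat_pow_0 r_null, metis nat_pow_eone)
  then obtain k where k: "n = Suc (Suc k)"
    by (metis One_nat_def not0_implies_Suc)
  define u where "u = b [^] Suc k"
  have u: "u \<in> carrier R" "c \<otimes> u = \<zero>" "u \<otimes> c \<noteq> \<zero>" "u \<otimes> (u \<otimes> c) = \<zero>"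
  proof -
    show "u \<in> carrier R" using ab by (simp add: u_def)
    have "u = b \<otimes> b [^] k"
      using ab unfolding u_def by (simp only: nat_pow_Suc2)
    then show "c \<otimes> u = \<zero>"
      using ab c by (simp flip: m_assoc)
    show "u \<otimes> c \<noteq> \<zero>"
      using n(2)[of "Suc k"] by (simp add: u_def k)
    have "u \<otimes> u = b [^] k \<otimes> b [^] n"
      unfolding u_def k using ab by (simp only: nat_pow_mult) simp
    then show "u \<otimes> (u \<otimes> c) = \<zero>"
      using ab c n(1) \<open>u \<in> carrier R\<close> by (simp flip: m_assoc) (simp add: m_assoc)
  qed
  obtain m :: nat where m: "u \<otimes> c [^] m = \<zero>" "\<And>k. k < m \<Longrightarrow> u \<otimes> c [^] k \<noteq> \<zero>"
    using exists_least_iff[of "\<lambda>n::nat. u \<otimes> c [^] n = \<zero>"]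
      semicommutative_annihilating_power(2)[OF R(1,3) c(1) u(1,2)] by blast
  have "m \<noteq> 0" "m \<noteq> 1"
    using m(1) c u by (metis l_null nat_pow_0 r_one, metis nat_pow_eone)
  then obtain j where j: "m = Suc (Suc j)"
    by (metis One_nat_def not0_implies_Suc)
  define v where "v = c [^] Suc j"
  have v_closed: "v \<in> carrier R" using c by (simp add: v_def)
  have v: "v = c \<otimes> c [^] j" "v = c [^] j \<otimes> c"
    unfolding v_def by (rule nat_pow_Suc2[OF c(1)], simp)
  have "skew_pair R u v"
  proof
    show "v \<otimes> u = \<zero>"
      using u c by (simp add: v(2) m_assoc)
    show "u \<otimes> v \<noteq> \<zero>"
      using m(2)[of "Suc j"] by (simp add: v_def j)
    show "u \<otimes> (u \<otimes> v) = \<zero>"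
    \<comment> \<open>The relation obtained for \<open>c\<close> survives the passage to
      \<open>v\<close>, because \<open>v\<close> is \<open>c\<close> followed by further powers of
      \<open>c\<close> on the right.\<close>
    proof -
      have "u \<otimes> (u \<otimes> v) = u \<otimes> (u \<otimes> c) \<otimes> c [^] j"
        using u(1) c by (simp add: v(1) m_assoc)
      then show ?thesis using u(4) c by simp
    qed
    have "v \<otimes> v = c [^] m \<otimes> c [^] j"
      unfolding v_def j using c by (simp only: nat_pow_mult) simp
    then have "u \<otimes> (v \<otimes> v) = u \<otimes> c [^] m \<otimes> c [^] j"
      using u(1) c by (simp add: m_assoc)
    then show "u \<otimes> v \<otimes> v = \<zero>"
      using m(1) u(1) c v_closed by (simp add: m_assoc)
  qed (use u v_closed in auto)
  then show ?thesis by blast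
qed

end

section \<open>Invariance under isomorphism and normalization of the skew pair\<close>

lemma ring_iso_transfer:
  assumes h: "h \<in> ring_iso R S" and R: "ring R" and S: "ring S"
  shows "semicommutative_ring R \<Longrightarrow> semicommutative_ring S"
    and "reflexive_ring R \<Longrightarrow> reflexive_ring S"
    and "duo_ring R \<Longrightarrow> duo_ring S"
proof -
  interpret R: ring R by fact
  interpret S: ring S by fact
  have mult: "h (a \<otimes>\<^bsub>R\<^esub> b) = h a \<otimes>\<^bsub>S\<^esub> h b" if "a \<in> carrier R" "b \<in> carrier R" for a b
    using ring_iso_memE(2)[OF h that] .
  have surj: "\<exists>a'\<in>carrier R. a = h a'" if "a \<in> carrier S" for a
    using ring_iso_memE(5)[OF h] that by (auto simp: bij_betw_def)
  have inj: "h a = h b \<longleftrightarrow> a = b" if "a \<in> carrier R" "b \<in> carrier R" for a b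
    using ring_iso_memE(5)[OF h] that by (auto simp: bij_betw_def inj_on_def)
  have zero: "h \<zero>\<^bsub>R\<^esub> = \<zero>\<^bsub>S\<^esub>"
    using h R S by (intro ring_hom_zero) (simp_all add: ring_iso_def)
  have closed: "h a \<in> carrier S" if "a \<in> carrier R" for a
    by (rule ring_iso_memE(1)[OF h that])
  have null2: "h a \<otimes>\<^bsub>S\<^esub> h b = \<zero>\<^bsub>S\<^esub> \<longleftrightarrow> a \<otimes>\<^bsub>R\<^esub> b = \<zero>\<^bsub>R\<^esub>"
    if "a \<in> carrier R" "b \<in> carrier R" for a b
    using that by (simp flip: mult zero add: inj)
  have null: "h a \<otimes>\<^bsub>S\<^esub> h r \<otimes>\<^bsub>S\<^esub> h b = \<zero>\<^bsub>S\<^esub> \<longleftrightarrow> a \<otimes>\<^bsub>R\<^esub> r \<otimes>\<^bsub>R\<^esub> b = \<zero>\<^bsub>R\<^esub>"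
    if "a \<in> carrier R" "r \<in> carrier R" "b \<in> carrier R" for a r b
    using that by (simp flip: mult zero add: inj)
  have carrier: "carrier S = h ` carrier R"
    using ring_iso_memE(5)[OF h] by (simp add: bij_betw_def)
  show "semicommutative_ring R \<Longrightarrow> semicommutative_ring S"
    unfolding semicommutative_ring_def carrier using S by (simp add: null2 null)
  show "reflexive_ring R \<Longrightarrow> reflexive_ring S"
    unfolding reflexive_ring_def carrier using S by (simp add: null)
  have duo: "h b \<otimes>\<^bsub>S\<^esub> h a \<in> h a <#\<^bsub>S\<^esub> carrier S \<longleftrightarrow> b \<otimes>\<^bsub>R\<^esub> a \<in> a <#\<^bsub>R\<^esub> carrier R"
    "h b \<otimes>\<^bsub>S\<^esub> h a \<in> carrier S #>\<^bsub>S\<^esub> h b \<longleftrightarrow> b \<otimes>\<^bsub>R\<^esub> a \<in> carrier R #>\<^bsub>R\<^esub> b"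
    if "a \<in> carrier R" "b \<in> carrier R" for a b
    unfolding l_coset_def r_coset_def carrier using that
    by (simp_all flip: mult add: inj)
  show "duo_ring R \<Longrightarrow> duo_ring S"
    unfolding duo_ring_def right_duo_ring_def left_duo_ring_def
    using S by (simp add: carrier[THEN equalityD1] duo, simp add: carrier duo[unfolded carrier])
qed

lemma iso_nonreflexive_semicommutative_nonduo:
  assumes "R \<simeq> S" "ring R" "ring S" "nonreflexive_semicommutative_nonduo R"
  shows "nonreflexive_semicommutative_nonduo S"
proof -
  obtain h where h: "h \<in> ring_iso R S"
    using assms(1) by (auto simp: is_ring_iso_def)
  \<comment> \<open>The negated properties travel from \<open>R\<close> to \<open>S\<close> by
    contraposition, along an isomorphism in the opposite direction.\<close>
  obtain k where k: "k \<in> ring_iso S R"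
    using ring_iso_sym[OF assms(2,1)] by (auto simp: is_ring_iso_def)
  show ?thesis
    using assms(2-4) ring_iso_transfer[OF h assms(2,3)] ring_iso_transfer[OF k assms(3,2)]
    unfolding nonreflexive_semicommutative_nonduo_def by blast
qed

lemma iso_order: "R \<simeq> S \<Longrightarrow> order R = order S"
  by (auto simp: is_ring_iso_def ring_iso_def order_def bij_betw_same_card)

lemma (in skew_pair) iso_form_ring_1_0:
  assumes R: "order R = 16" "\<not> duo_ring R"
  shows "\<exists>e. R \<simeq> form_ring e 1 0"
proof -
  obtain e p q where epq: "\<one> \<oplus> \<one> = bit_mult R e s" "u \<otimes> u = bit_mult R p s"
    "v \<otimes> v = bit_mult R q s" "s \<oplus> s = \<zero>"
    using structure_constants[OF R(1)] .
  \<comment> \<open>The new pair has the same product \<open>s\<close>, so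
    \<open>1 + 1 = e s\<close> and \<open>s + s = 0\<close> carry over with the same
    \<open>e\<close>.\<close>
  have new: ?thesis if uv': "u' \<in> carrier R" "v' \<in> carrier R" "u' \<otimes> v' = s" "v' \<otimes> u' = \<zero>"
    "u' \<otimes> u' = s" "v' \<otimes> v' = \<zero>" "u' \<otimes> s = \<zero>" "s \<otimes> v' = \<zero>" for u' v'
  proof -
    interpret new: skew_pair R u' v'
      using uv' uv by unfold_locales simp_all
    show ?thesis
      using new.iso_form_ring[of e 1 0] R(1) epq uv' by auto
  qed
  consider "p = 1" "q = 1" | "p = 1" "q = 0" | "p = 0" "q = 1" | "p = 0" "q = 0"
    using bit_not_one_iff by blast
  then show ?thesis
  proof cases
    case 1
    then have "form_ring e 1 1 \<simeq> R"
      using iso_form_ring[OF R(1) epq] ring_iso_sym[OF ring_axioms] by simp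
    then have "duo_ring R"
      using ring_iso_transfer(3)[OF _ ring_form_ring ring_axioms duo_form_ring]
      by (auto simp: is_ring_iso_def)
    with R(2) show ?thesis by simp
  next
    case 2
    then show ?thesis
      using new[of u v] epq by simp
  next
    \<comment> \<open>The isotropic combinations are \<open>u\<close> and \<open>u + v\<close>. The
      second is taken because \<open>(u + v) v = s + s = 0\<close>, as required of a pair whose
      first member is \<open>v\<close>.\<close>
    case 3
    show ?thesis
      by (rule new[of v "u \<oplus> v"]) (use epq 3 in \<open>simp_all add: l_distr r_distr\<close>)
  next
    \<comment> \<open>Here \<open>v\<close> is already isotropic, and
      \<open>(u + v) (u + v) = u v = s\<close> repairs the vanishing square of
      \<open>u\<close>.\<close>
    case 4
    show ?thesis
      by (rule new[of "u \<oplus> v" v]) (use epq 4 in \<open>simp_all add: l_distr r_distr\<close>)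
  qed
qed

section \<open>Free algebras\<close>

lemma free_algebra_simps [simp]:
  "f \<in> carrier (free_algebra A) \<longleftrightarrow> range f \<subseteq> carrier A \<and> finite {w. f w \<noteq> \<zero>\<^bsub>A\<^esub>}"
  "(f \<oplus>\<^bsub>free_algebra A\<^esub> g) w = f w \<oplus>\<^bsub>A\<^esub> g w"
  "\<zero>\<^bsub>free_algebra A\<^esub> w = \<zero>\<^bsub>A\<^esub>"
  "\<one>\<^bsub>free_algebra A\<^esub> w = (if w = [] then \<one>\<^bsub>A\<^esub> else \<zero>\<^bsub>A\<^esub>)"
  by (simp_all add: free_algebra_def)

context ring
begin

lemma free_mult_Nil:
  assumes "range f \<subseteq> carrier R" "range g \<subseteq> carrier R"
  shows "(f \<otimes>\<^bsub>free_algebra R\<^esub> g) [] = f [] \<otimes> g []"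
proof -
  have "f [] \<otimes> g [] \<in> carrier R"
    using assms by (intro m_closed) auto
  then show ?thesis
    by (simp add: free_algebra_def)
qed

text \<open>The empty prefix gives the first summand; all other splittings of \<open>x # w\<close>
  are splittings of \<open>w\<close> for the left quotient \<open>\<lambda>w. f (x # w)\<close>.
  This recursion replaces manipulations of the convolution sum by inductions on the word with
  \<open>f\<close> arbitrary.\<close>

lemma free_mult_Cons:
  assumes "range f \<subseteq> carrier R" "range g \<subseteq> carrier R"
  shows "(f \<otimes>\<^bsub>free_algebra R\<^esub> g) (x # w) =
    f [] \<otimes> g (x # w) \<oplus> ((\<lambda>w. f (x # w)) \<otimes>\<^bsub>free_algebra R\<^esub> g) w"
proof -
  have closed: "f v \<in> carrier R" "g v \<in> carrier R" for v
    using assms by auto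
  have "(f \<otimes>\<^bsub>free_algebra R\<^esub> g) (x # w) =
      (\<Oplus>i\<in>{..Suc (length w)}. f (take i (x # w)) \<otimes> g (drop i (x # w)))"
    by (simp add: free_algebra_def)
  also have "\<dots> = (\<Oplus>i\<in>{..length w}. f (take (Suc i) (x # w)) \<otimes> g (drop (Suc i) (x # w)))
      \<oplus> f [] \<otimes> g (x # w)"
    by (subst finsum_Suc2) (auto simp: closed)
  also have "\<dots> = f [] \<otimes> g (x # w) \<oplus>
      (\<Oplus>i\<in>{..length w}. f (take (Suc i) (x # w)) \<otimes> g (drop (Suc i) (x # w)))"
    by (intro a_comm finsum_closed) (auto simp: closed)
  finally show ?thesis
    by (simp add: free_algebra_def)
qed

lemma free_mult_closed:
  assumes "range f \<subseteq> carrier R" "range g \<subseteq> carrier R"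
  shows "(f \<otimes>\<^bsub>free_algebra R\<^esub> g) w \<in> carrier R"
  using assms
  by (auto simp: free_algebra_def intro!: finsum_closed m_closed)

lemmas free_mult = free_mult_Nil free_mult_Cons free_mult_closed

lemma free_mult_zero_left:
  assumes "range g \<subseteq> carrier R"
  shows "((\<lambda>w. \<zero>) \<otimes>\<^bsub>free_algebra R\<^esub> g) w = \<zero>"
proof (induction w)
  case (Cons x w)
  have "g v \<in> carrier R" for v using assms by auto
  with Cons show ?case using assms by (simp add: free_mult image_subset_iff)
qed (use assms in \<open>simp add: free_mult image_subset_iff\<close>)

lemma free_mult_scale_left:
  assumes "c \<in> carrier R" "range f \<subseteq> carrier R" "range g \<subseteq> carrier R"
  shows "((\<lambda>w. c \<otimes> f w) \<otimes>\<^bsub>free_algebra R\<^esub> g) w = c \<otimes> (f \<otimes>\<^bsub>free_algebra R\<^esub> g) w"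
  using assms(2)
proof (induction w arbitrary: f)
  case Nil
  then have "f v \<in> carrier R" "g v \<in> carrier R" for v using assms by auto
  with Nil show ?case using assms by (simp add: free_mult image_subset_iff m_assoc)
next
  case (Cons x w)
  then have closed: "f v \<in> carrier R" "g v \<in> carrier R" for v using assms by auto
  have ih: "((\<lambda>w. c \<otimes> f (x # w)) \<otimes>\<^bsub>free_algebra R\<^esub> g) w
      = c \<otimes> ((\<lambda>w. f (x # w)) \<otimes>\<^bsub>free_algebra R\<^esub> g) w"
    using Cons.IH[of "\<lambda>w. f (x # w)"] closed by (simp add: image_subset_iff)
  show ?case
    using assms closed by (simp add: free_mult image_subset_iff m_assoc r_distr ih)
qed

lemma free_mult_add_left:
  assumes "range f \<subseteq> carrier R" "range g \<subseteq> carrier R" "range h \<subseteq> carrier R"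
  shows "((\<lambda>w. f w \<oplus> g w) \<otimes>\<^bsub>free_algebra R\<^esub> h) w =
    (f \<otimes>\<^bsub>free_algebra R\<^esub> h) w \<oplus> (g \<otimes>\<^bsub>free_algebra R\<^esub> h) w"
  using assms(1,2)
proof (induction w arbitrary: f g)
  case Nil
  then have "f v \<in> carrier R" "g v \<in> carrier R" "h v \<in> carrier R" for v using assms by auto
  with Nil show ?case using assms by (simp add: free_mult image_subset_iff l_distr)
next
  case (Cons x w)
  then have closed: "f v \<in> carrier R" "g v \<in> carrier R" "h v \<in> carrier R" for v
    using assms by auto
  have ih: "((\<lambda>w. f (x # w) \<oplus> g (x # w)) \<otimes>\<^bsub>free_algebra R\<^esub> h) w =
      ((\<lambda>w. f (x # w)) \<otimes>\<^bsub>free_algebra R\<^esub> h) w \<oplus> ((\<lambda>w. g (x # w)) \<otimes>\<^bsub>free_algebra R\<^esub> h) w"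
    using Cons.IH[of "\<lambda>w. f (x # w)" "\<lambda>w. g (x # w)"] closed by (simp add: image_subset_iff)
  show ?case
    using assms closed by (simp add: free_mult image_subset_iff l_distr ih a_ac)
qed

lemma free_mult_add_right:
  assumes "range f \<subseteq> carrier R" "range g \<subseteq> carrier R" "range h \<subseteq> carrier R"
  shows "(f \<otimes>\<^bsub>free_algebra R\<^esub> (\<lambda>w. g w \<oplus> h w)) w =
    (f \<otimes>\<^bsub>free_algebra R\<^esub> g) w \<oplus> (f \<otimes>\<^bsub>free_algebra R\<^esub> h) w"
  using assms(1)
proof (induction w arbitrary: f)
  case Nil
  then have "f v \<in> carrier R" "g v \<in> carrier R" "h v \<in> carrier R" for v using assms by auto
  with Nil show ?case using assms by (simp add: free_mult image_subset_iff r_distr)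
next
  case (Cons x w)
  then have closed: "f v \<in> carrier R" "g v \<in> carrier R" "h v \<in> carrier R" for v
    using assms by auto
  have ih: "((\<lambda>w. f (x # w)) \<otimes>\<^bsub>free_algebra R\<^esub> (\<lambda>w. g w \<oplus> h w)) w =
      ((\<lambda>w. f (x # w)) \<otimes>\<^bsub>free_algebra R\<^esub> g) w \<oplus> ((\<lambda>w. f (x # w)) \<otimes>\<^bsub>free_algebra R\<^esub> h) w"
    using Cons.IH[of "\<lambda>w. f (x # w)"] closed by (simp add: image_subset_iff)
  show ?case
    using assms closed by (simp add: free_mult image_subset_iff r_distr ih a_ac)
qed

text \<open>Writing \<open>f_x\<close> for the left quotient by the letter \<open>x\<close>, the
  left quotient of \<open>f g\<close> is \<open>f [] g_x + f_x g\<close>. Linearity in the left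
  factor handles the first term, the induction hypothesis for \<open>f_x\<close> the second.\<close>

lemma free_mult_assoc:
  assumes "range f \<subseteq> carrier R" "range g \<subseteq> carrier R" "range h \<subseteq> carrier R"
  shows "(f \<otimes>\<^bsub>free_algebra R\<^esub> g \<otimes>\<^bsub>free_algebra R\<^esub> h) w =
    (f \<otimes>\<^bsub>free_algebra R\<^esub> (g \<otimes>\<^bsub>free_algebra R\<^esub> h)) w"
  using assms(1)
proof (induction w arbitrary: f)
  case Nil
  then have "f v \<in> carrier R" "g v \<in> carrier R" "h v \<in> carrier R" for v using assms by auto
  with Nil show ?case using assms by (simp add: free_mult image_subset_iff m_assoc)
next
  case (Cons x w)
  then have closed: "f v \<in> carrier R" "g v \<in> carrier R" "h v \<in> carrier R" for v
    using assms by auto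
  let ?fx = "\<lambda>w. f (x # w)" and ?gx = "\<lambda>w. g (x # w)"
  have ranges: "range ?fx \<subseteq> carrier R" "range ?gx \<subseteq> carrier R"
    "range (f \<otimes>\<^bsub>free_algebra R\<^esub> g) \<subseteq> carrier R"
    "range (?fx \<otimes>\<^bsub>free_algebra R\<^esub> g) \<subseteq> carrier R"
    "range (g \<otimes>\<^bsub>free_algebra R\<^esub> h) \<subseteq> carrier R"
    using Cons.prems assms closed by (auto simp: free_mult image_subset_iff)
  have "(f \<otimes>\<^bsub>free_algebra R\<^esub> g \<otimes>\<^bsub>free_algebra R\<^esub> h) (x # w) =
      f [] \<otimes> g [] \<otimes> h (x # w) \<oplus>
      ((\<lambda>w. f [] \<otimes> ?gx w \<oplus> (?fx \<otimes>\<^bsub>free_algebra R\<^esub> g) w) \<otimes>\<^bsub>free_algebra R\<^esub> h) w"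
    using Cons.prems assms ranges by (simp add: free_mult_Cons free_mult_Nil)
  also have "((\<lambda>w. f [] \<otimes> ?gx w \<oplus> (?fx \<otimes>\<^bsub>free_algebra R\<^esub> g) w) \<otimes>\<^bsub>free_algebra R\<^esub> h) w =
      f [] \<otimes> (?gx \<otimes>\<^bsub>free_algebra R\<^esub> h) w \<oplus>
      (?fx \<otimes>\<^bsub>free_algebra R\<^esub> (g \<otimes>\<^bsub>free_algebra R\<^esub> h)) w"
    using assms ranges closed Cons.IH[OF ranges(1)]
    by (simp add: free_mult_add_left free_mult_scale_left image_subset_iff)
  finally show ?case
    using Cons.prems assms ranges closed
    by (simp add: free_mult image_subset_iff m_assoc a_assoc r_distr)
qed

lemma ring_free_algebra: "ring (free_algebra R)"
proof -
  let ?P = "free_algebra R"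
  have mult_closed: "f \<otimes>\<^bsub>?P\<^esub> g \<in> carrier ?P"
    if f: "f \<in> carrier ?P" and g: "g \<in> carrier ?P" for f g :: "'x list \<Rightarrow> 'a"
  proof -
    have fg: "f v \<in> carrier R" "g v \<in> carrier R" for v using f g by auto
    have "{w. (f \<otimes>\<^bsub>?P\<^esub> g) w \<noteq> \<zero>} \<subseteq> (\<lambda>(v, w). v @ w) ` ({w. f w \<noteq> \<zero>} \<times> {w. g w \<noteq> \<zero>})"
    proof (rule subsetI, rule ccontr)
      fix w assume w: "w \<in> {w. (f \<otimes>\<^bsub>?P\<^esub> g) w \<noteq> \<zero>}"
        and "w \<notin> (\<lambda>(v, w). v @ w) ` ({w. f w \<noteq> \<zero>} \<times> {w. g w \<noteq> \<zero>})"
      then have "f (take i w) = \<zero> \<or> g (drop i w) = \<zero>" for i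
        by (auto simp: image_iff) (metis append_take_drop_id)
      then have "f (take i w) \<otimes> g (drop i w) = \<zero>" for i
        using fg by (metis l_null r_null)
      with w show False by (simp add: free_algebra_def)
    qed
    then show ?thesis
      using f g finite_subset by (fastforce simp: free_mult image_subset_iff)
  qed
  have add_finite: "finite {w. f w \<oplus> g w \<noteq> \<zero>}"
    if "f \<in> carrier ?P" "g \<in> carrier ?P" for f g :: "'x list \<Rightarrow> 'a"
  proof (rule finite_subset)
    show "{w. f w \<oplus> g w \<noteq> \<zero>} \<subseteq> {w. f w \<noteq> \<zero>} \<union> {w. g w \<noteq> \<zero>}" by auto
  qed (use that in simp)
  show ?thesis
  proof (intro ringI abelian_groupI monoidI)
    fix f :: "'x list \<Rightarrow> 'a" assume f: "f \<in> carrier ?P"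
    then have f': "f v \<in> carrier R" for v by auto
    have "{w. \<ominus> f w \<noteq> \<zero>} = {w. f w \<noteq> \<zero>}"
      using f' by (metis minus_minus minus_zero)
    then show "\<exists>g\<in>carrier ?P. g \<oplus>\<^bsub>?P\<^esub> f = \<zero>\<^bsub>?P\<^esub>"
      using f f' by (intro bexI[of _ "\<lambda>w. \<ominus> f w"]) (auto simp: fun_eq_iff l_neg)
    show "\<one>\<^bsub>?P\<^esub> \<otimes>\<^bsub>?P\<^esub> f = f"
    proof
      fix w show "(\<one>\<^bsub>?P\<^esub> \<otimes>\<^bsub>?P\<^esub> f) w = f w"
        using f f' by (cases w) (auto simp: free_mult image_subset_iff free_mult_zero_left)
    qed
    show "f \<otimes>\<^bsub>?P\<^esub> \<one>\<^bsub>?P\<^esub> = f"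
    proof
      fix w
      have "range f \<subseteq> carrier R" using f by simp
      then show "(f \<otimes>\<^bsub>?P\<^esub> \<one>\<^bsub>?P\<^esub>) w = f w"
      proof (induction w arbitrary: f)
        case (Cons x w)
        then have "f v \<in> carrier R" for v by auto
        with Cons show ?case by (simp add: free_mult image_subset_iff)
      qed (auto simp: free_mult image_subset_iff)
    qed
  next
    fix f g h :: "'x list \<Rightarrow> 'a"
    assume fgh: "f \<in> carrier ?P" "g \<in> carrier ?P" "h \<in> carrier ?P"
    have add: "p \<oplus>\<^bsub>?P\<^esub> q = (\<lambda>w. p w \<oplus> q w)" for p q :: "'x list \<Rightarrow> 'a"
      by (simp add: fun_eq_iff)
    show "(f \<oplus>\<^bsub>?P\<^esub> g) \<otimes>\<^bsub>?P\<^esub> h = f \<otimes>\<^bsub>?P\<^esub> h \<oplus>\<^bsub>?P\<^esub> g \<otimes>\<^bsub>?P\<^esub> h"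
      using fgh by (simp add: fun_eq_iff add free_mult_add_left)
    show "h \<otimes>\<^bsub>?P\<^esub> (f \<oplus>\<^bsub>?P\<^esub> g) = h \<otimes>\<^bsub>?P\<^esub> f \<oplus>\<^bsub>?P\<^esub> h \<otimes>\<^bsub>?P\<^esub> g"
      using fgh by (simp add: fun_eq_iff add free_mult_add_right)
    show "f \<otimes>\<^bsub>?P\<^esub> g \<otimes>\<^bsub>?P\<^esub> h = f \<otimes>\<^bsub>?P\<^esub> (g \<otimes>\<^bsub>?P\<^esub> h)"
      using fgh by (simp add: fun_eq_iff free_mult_assoc)
    show "f \<oplus>\<^bsub>?P\<^esub> g \<oplus>\<^bsub>?P\<^esub> h = f \<oplus>\<^bsub>?P\<^esub> (g \<oplus>\<^bsub>?P\<^esub> h)"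
      using fgh by (auto simp: fun_eq_iff image_subset_iff a_assoc)
  next
    fix f g :: "'x list \<Rightarrow> 'a"
    assume fg: "f \<in> carrier ?P" "g \<in> carrier ?P"
    show "f \<oplus>\<^bsub>?P\<^esub> g \<in> carrier ?P"
      using fg add_finite[OF fg] by (auto simp: image_subset_iff)
    show "f \<oplus>\<^bsub>?P\<^esub> g = g \<oplus>\<^bsub>?P\<^esub> f"
      using fg by (auto simp: fun_eq_iff image_subset_iff a_comm)
    show "f \<otimes>\<^bsub>?P\<^esub> g \<in> carrier ?P"
      by (rule mult_closed[OF fg])
  next
    fix f :: "'x list \<Rightarrow> 'a" assume "f \<in> carrier ?P"
    then show "\<zero>\<^bsub>?P\<^esub> \<oplus>\<^bsub>?P\<^esub> f = f"
      by (auto simp: fun_eq_iff image_subset_iff)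
  qed (auto intro: finite_subset[of _ "{[]}"])
qed

lemma free_gen_closed [simp]: "free_gen R x \<in> carrier (free_algebra R)"
  by (auto simp: free_gen_def intro: finite_subset[of _ "{[x]}"])

lemma free_gen_mult:
  assumes "range g \<subseteq> carrier R"
  shows "(free_gen R x \<otimes>\<^bsub>free_algebra R\<^esub> g) [] = \<zero>"
    and "(free_gen R x \<otimes>\<^bsub>free_algebra R\<^esub> g) (y # w) = (if x = y then g w else \<zero>)"
proof -
  have g: "g v \<in> carrier R" for v using assms by auto
  interpret P: ring "free_algebra R :: ('b list \<Rightarrow> 'a) ring" by (rule ring_free_algebra)
  have x: "range (free_gen R x) \<subseteq> carrier R"
    using free_gen_closed[of x] by simp
  show "(free_gen R x \<otimes>\<^bsub>free_algebra R\<^esub> g) [] = \<zero>"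
    using assms x g by (simp add: free_mult) (simp add: free_gen_def)
  have "(\<lambda>w. free_gen R x (y # w)) =
      (if x = y then \<one>\<^bsub>free_algebra R\<^esub> else (\<lambda>w. \<zero>))"
    by (auto simp: free_gen_def fun_eq_iff)
  moreover have "(\<one>\<^bsub>free_algebra R\<^esub> \<otimes>\<^bsub>free_algebra R\<^esub> g) w = g w"
    using assms g by (cases w) (auto simp: free_mult image_subset_iff free_mult_zero_left)
  moreover have "free_gen R x [] = \<zero>"
    by (simp add: free_gen_def)
  ultimately show "(free_gen R x \<otimes>\<^bsub>free_algebra R\<^esub> g) (y # w) = (if x = y then g w else \<zero>)"
    using assms x g by (simp add: free_mult_Cons free_mult_zero_left)
qed

end

section \<open>Normal forms modulo the quadratic relations\<close>

definition free_const :: "('a, 'm) ring_scheme \<Rightarrow> 'a \<Rightarrow> 'x list \<Rightarrow> 'a" where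
  "free_const A c = (\<lambda>w. if w = [] then c else \<zero>\<^bsub>A\<^esub>)"

context ring
begin

lemma free_const_closed: "c \<in> carrier R \<Longrightarrow> free_const R c \<in> carrier (free_algebra R)"
  by (auto simp: free_const_def intro: finite_subset[of _ "{[]}"])

lemma free_algebra_Cons_closed:
  assumes "f \<in> carrier (free_algebra R)"
  shows "(\<lambda>w. f (x # w)) \<in> carrier (free_algebra R)"
proof -
  have "{w. f (x # w) \<noteq> \<zero>} = (#) x -` {w. f w \<noteq> \<zero>}"
    by auto
  moreover have "finite ((#) x -` {w. f w \<noteq> \<zero>})"
    using assms by (intro finite_vimageI) (auto simp: inj_def)
  ultimately show ?thesis
    using assms by auto
qed

lemma free_algebra_decomp:
  fixes f :: "gens list \<Rightarrow> 'a"
  assumes "f \<in> carrier (free_algebra R)"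
  shows "f = free_const R (f []) \<oplus>\<^bsub>free_algebra R\<^esub>
    free_gen R U \<otimes>\<^bsub>free_algebra R\<^esub> (\<lambda>w. f (U # w)) \<oplus>\<^bsub>free_algebra R\<^esub>
    free_gen R V \<otimes>\<^bsub>free_algebra R\<^esub> (\<lambda>w. f (V # w))"
proof
  fix w
  have f: "f v \<in> carrier R" "range (\<lambda>w. f (x # w)) \<subseteq> carrier R" for v x
    using assms by auto
  show "f w = (free_const R (f []) \<oplus>\<^bsub>free_algebra R\<^esub>
    free_gen R U \<otimes>\<^bsub>free_algebra R\<^esub> (\<lambda>w. f (U # w)) \<oplus>\<^bsub>free_algebra R\<^esub>
    free_gen R V \<otimes>\<^bsub>free_algebra R\<^esub> (\<lambda>w. f (V # w))) w"
  proof (cases w)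
    case (Cons x w')
    then show ?thesis
      by (cases x) (simp_all add: free_gen_mult f free_const_def)
  qed (simp add: free_gen_mult f free_const_def)
qed

text \<open>Two letters are split off \<open>f\<close>. Words starting with \<open>V\<close> and a
  second letter lie in \<open>I\<close>, and a prefix \<open>U U\<close> may be replaced by
  \<open>U V\<close>. Splitting one more letter off the joint cofactor of \<open>u v\<close> leaves
  only its constant term, since \<open>u v u\<close> and \<open>u v v\<close> lie in
  \<open>I\<close>.\<close>

lemma free_algebra_normal_form:
  fixes f :: "gens list \<Rightarrow> 'a" and P u v
  defines "P \<equiv> free_algebra R" and "u \<equiv> free_gen R U" and "v \<equiv> free_gen R V"
  assumes I: "ideal I P" and f: "f \<in> carrier P"
    and rels: "v \<otimes>\<^bsub>P\<^esub> u \<in> I" "v \<otimes>\<^bsub>P\<^esub> v \<in> I" "u \<otimes>\<^bsub>P\<^esub> u \<ominus>\<^bsub>P\<^esub> u \<otimes>\<^bsub>P\<^esub> v \<in> I"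
  shows "\<exists>i\<in>I. f = free_const R (f []) \<oplus>\<^bsub>P\<^esub> u \<otimes>\<^bsub>P\<^esub> free_const R (f [U]) \<oplus>\<^bsub>P\<^esub>
    v \<otimes>\<^bsub>P\<^esub> free_const R (f [V]) \<oplus>\<^bsub>P\<^esub>
    u \<otimes>\<^bsub>P\<^esub> v \<otimes>\<^bsub>P\<^esub> free_const R (f [U, U] \<oplus> f [U, V]) \<oplus>\<^bsub>P\<^esub> i"
proof -
  interpret P: ring P
    unfolding P_def by (rule ring_free_algebra)
  interpret I: ideal I P by fact
  have uv [simp]: "u \<in> carrier P" "v \<in> carrier P"
    unfolding u_def v_def P_def by (rule free_gen_closed)+
  have coeff: "g w \<in> carrier R" if "g \<in> carrier P" for g :: "gens list \<Rightarrow> 'a" and w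
    using that by (auto simp: P_def)
  have const [simp]: "free_const R c \<in> carrier P" if "c \<in> carrier R" for c
    using free_const_closed[OF that] by (simp add: P_def)
  have tail: "(\<lambda>w. g (x # w)) \<in> carrier P" if "g \<in> carrier P" for g and x :: gens
    using that unfolding P_def by (rule free_algebra_Cons_closed)
  note decomp = free_algebra_decomp[folded P_def u_def v_def]
  \<comment> \<open>The cofactor of \<open>u v\<close> once \<open>u u\<close> has been replaced by
    \<open>u v\<close>.\<close>
  define g where "g = (\<lambda>w. f (U # U # w)) \<oplus>\<^bsub>P\<^esub> (\<lambda>w. f (U # V # w))"
  obtain g1 g2 g3 g4 where "g1 = (\<lambda>w. f (U # U # w))" "g2 = (\<lambda>w. f (U # V # w))"
    "g3 = (\<lambda>w. f (V # U # w))" "g4 = (\<lambda>w. f (V # V # w))"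
    by blast
  note gs = this
  obtain h k where hk: "h = (\<lambda>w. g (U # w))" "k = (\<lambda>w. g (V # w))"
    by blast
  have g14 [simp]: "g1 \<in> carrier P" "g2 \<in> carrier P" "g3 \<in> carrier P" "g4 \<in> carrier P"
    by (simp_all add: gs tail[OF tail[OF f]])
  then have g_closed [simp]: "g \<in> carrier P"
    unfolding g_def gs by simp
  then have [simp]: "h \<in> carrier P" "k \<in> carrier P"
    unfolding hk by (intro tail; simp)+
  obtain c0 c1 c2 c :: "gens list \<Rightarrow> 'a" where cs: "c0 = free_const R (f [])" "c1 = free_const R (f [U])"
    "c2 = free_const R (f [V])" "c = free_const R (f [U, U] \<oplus> f [U, V])"
    by blast
  have [simp]: "c0 \<in> carrier P" "c1 \<in> carrier P" "c2 \<in> carrier P" "c \<in> carrier P"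
    unfolding cs by (simp_all add: coeff[OF f])
  have "g [] = f [U, U] \<oplus> f [U, V]"
    by (simp add: g_def P_def)
  then have g: "g = c \<oplus>\<^bsub>P\<^esub> u \<otimes>\<^bsub>P\<^esub> h \<oplus>\<^bsub>P\<^esub> v \<otimes>\<^bsub>P\<^esub> k"
    using decomp[OF g_closed] by (simp add: cs hk)
  have fU: "(\<lambda>w. f (U # w)) = c1 \<oplus>\<^bsub>P\<^esub> u \<otimes>\<^bsub>P\<^esub> g1 \<oplus>\<^bsub>P\<^esub> v \<otimes>\<^bsub>P\<^esub> g2"
    using decomp[OF tail[OF f, of U]] by (simp add: cs gs)
  have fV: "(\<lambda>w. f (V # w)) = c2 \<oplus>\<^bsub>P\<^esub> u \<otimes>\<^bsub>P\<^esub> g3 \<oplus>\<^bsub>P\<^esub> v \<otimes>\<^bsub>P\<^esub> g4"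
    using decomp[OF tail[OF f, of V]] by (simp add: cs gs)
  \<comment> \<open>Everything discarded: the error of replacing \<open>u u\<close> by
    \<open>u v\<close>, and the parts with prefixes \<open>U V U\<close>, \<open>U V V\<close>,
    \<open>V U\<close> and \<open>V V\<close>.\<close>
  define i where "i = (u \<otimes>\<^bsub>P\<^esub> u \<ominus>\<^bsub>P\<^esub> u \<otimes>\<^bsub>P\<^esub> v) \<otimes>\<^bsub>P\<^esub> g1 \<oplus>\<^bsub>P\<^esub>
    (u \<otimes>\<^bsub>P\<^esub> (v \<otimes>\<^bsub>P\<^esub> u)) \<otimes>\<^bsub>P\<^esub> h \<oplus>\<^bsub>P\<^esub> (u \<otimes>\<^bsub>P\<^esub> (v \<otimes>\<^bsub>P\<^esub> v)) \<otimes>\<^bsub>P\<^esub> k \<oplus>\<^bsub>P\<^esub>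
    (v \<otimes>\<^bsub>P\<^esub> u) \<otimes>\<^bsub>P\<^esub> g3 \<oplus>\<^bsub>P\<^esub> (v \<otimes>\<^bsub>P\<^esub> v) \<otimes>\<^bsub>P\<^esub> g4"
  have "i \<in> I"
    unfolding i_def using rels
    by (simp add: I.a_closed I.I_r_closed I.I_l_closed)
  define d where "d = (u \<otimes>\<^bsub>P\<^esub> u \<ominus>\<^bsub>P\<^esub> u \<otimes>\<^bsub>P\<^esub> v) \<otimes>\<^bsub>P\<^esub> g1"
  have [simp]: "d \<in> carrier P"
    by (simp add: d_def)
  have uu: "u \<otimes>\<^bsub>P\<^esub> (u \<otimes>\<^bsub>P\<^esub> g1) = d \<oplus>\<^bsub>P\<^esub> u \<otimes>\<^bsub>P\<^esub> (v \<otimes>\<^bsub>P\<^esub> g1)"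
    by (simp add: d_def P.minus_eq P.l_distr P.l_minus P.m_assoc P.a_assoc P.l_neg)
  have "f = c0 \<oplus>\<^bsub>P\<^esub> u \<otimes>\<^bsub>P\<^esub> (c1 \<oplus>\<^bsub>P\<^esub> u \<otimes>\<^bsub>P\<^esub> g1 \<oplus>\<^bsub>P\<^esub> v \<otimes>\<^bsub>P\<^esub> g2) \<oplus>\<^bsub>P\<^esub>
      v \<otimes>\<^bsub>P\<^esub> (c2 \<oplus>\<^bsub>P\<^esub> u \<otimes>\<^bsub>P\<^esub> g3 \<oplus>\<^bsub>P\<^esub> v \<otimes>\<^bsub>P\<^esub> g4)"
    using decomp[OF f] unfolding fU fV cs .
  also have "\<dots> = c0 \<oplus>\<^bsub>P\<^esub> u \<otimes>\<^bsub>P\<^esub> c1 \<oplus>\<^bsub>P\<^esub> v \<otimes>\<^bsub>P\<^esub> c2 \<oplus>\<^bsub>P\<^esub> u \<otimes>\<^bsub>P\<^esub> v \<otimes>\<^bsub>P\<^esub> (g1 \<oplus>\<^bsub>P\<^esub> g2) \<oplus>\<^bsub>P\<^esub>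
      (d \<oplus>\<^bsub>P\<^esub> v \<otimes>\<^bsub>P\<^esub> u \<otimes>\<^bsub>P\<^esub> g3 \<oplus>\<^bsub>P\<^esub> v \<otimes>\<^bsub>P\<^esub> v \<otimes>\<^bsub>P\<^esub> g4)"
    by (simp add: P.r_distr P.m_assoc P.a_ac uu)
  also have "g1 \<oplus>\<^bsub>P\<^esub> g2 = c \<oplus>\<^bsub>P\<^esub> u \<otimes>\<^bsub>P\<^esub> h \<oplus>\<^bsub>P\<^esub> v \<otimes>\<^bsub>P\<^esub> k"
    unfolding g[symmetric] g_def gs ..
  also have "c0 \<oplus>\<^bsub>P\<^esub> u \<otimes>\<^bsub>P\<^esub> c1 \<oplus>\<^bsub>P\<^esub> v \<otimes>\<^bsub>P\<^esub> c2 \<oplus>\<^bsub>P\<^esub>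
      u \<otimes>\<^bsub>P\<^esub> v \<otimes>\<^bsub>P\<^esub> (c \<oplus>\<^bsub>P\<^esub> u \<otimes>\<^bsub>P\<^esub> h \<oplus>\<^bsub>P\<^esub> v \<otimes>\<^bsub>P\<^esub> k) \<oplus>\<^bsub>P\<^esub>
      (d \<oplus>\<^bsub>P\<^esub> v \<otimes>\<^bsub>P\<^esub> u \<otimes>\<^bsub>P\<^esub> g3 \<oplus>\<^bsub>P\<^esub> v \<otimes>\<^bsub>P\<^esub> v \<otimes>\<^bsub>P\<^esub> g4) =
      c0 \<oplus>\<^bsub>P\<^esub> u \<otimes>\<^bsub>P\<^esub> c1 \<oplus>\<^bsub>P\<^esub> v \<otimes>\<^bsub>P\<^esub> c2 \<oplus>\<^bsub>P\<^esub> u \<otimes>\<^bsub>P\<^esub> v \<otimes>\<^bsub>P\<^esub> c \<oplus>\<^bsub>P\<^esub> i"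
    unfolding i_def d_def[symmetric]
    by (simp add: P.r_distr P.m_assoc P.a_ac)
  finally show ?thesis
    using \<open>i \<in> I\<close> unfolding cs by blast
qed

end

section \<open>The two presentations\<close>

lemma of_int_bit_mod: "even m \<Longrightarrow> of_int (k mod m) = (of_int k :: bit)"
proof -
  have "of_int k = (if even k then 0 else 1 :: bit)" for k
    by (auto elim!: evenE oddE)
  then show "even m \<Longrightarrow> of_int (k mod m) = (of_int k :: bit)"
    by (simp add: dvd_mod_iff)
qed

text \<open>With 2 equal to \<open>u v\<close>, the second binary digit of the constant coefficient contributes to the
  coefficient of \<open>u v\<close>; over \<open>Z/2\<close> this digit vanishes.\<close>

definition form_map :: "(gens list \<Rightarrow> int) \<Rightarrow> quad" where
  "form_map f = (of_int (f []), of_int (f [U]), of_int (f [V]),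
     of_int (f [] div 2) + of_int (f [U, U]) + of_int (f [U, V]))"

lemma residue_ring_simps:
  "carrier (residue_ring m) = {0..m - 1}"
  "x \<otimes>\<^bsub>residue_ring m\<^esub> y = x * y mod m"
  "x \<oplus>\<^bsub>residue_ring m\<^esub> y = (x + y) mod m"
  "\<one>\<^bsub>residue_ring m\<^esub> = 1" "\<zero>\<^bsub>residue_ring m\<^esub> = 0"
  by (simp_all add: residue_ring_def)

text \<open>Binary arithmetic modulo 4: the carry in a sum is the product of the low digits, and a
  product gets its second digit from the mixed terms. For modulus 2 all second digits are zero. The
  formulas are those of the last coordinate in \<open>form_ring\<close>.\<close>

lemma second_digit:
  fixes a b m :: int
  assumes "m = 2 \<and> e = 0 \<or> m = 4 \<and> e = 1" "a \<in> {0..m - 1}" "b \<in> {0..m - 1}"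
  shows "(of_int ((a + b) mod m div 2) :: bit) = of_int (a div 2) + of_int (b div 2) + e * of_int a * of_int b"
    and "(of_int (a * b mod m div 2) :: bit) = of_int a * of_int (b div 2) + of_int (a div 2) * of_int b"
proof -
  have "a \<in> {0, 1} \<and> b \<in> {0, 1} \<and> m = 2 \<and> e = 0 \<or>
      a \<in> {0, 1, 2, 3} \<and> b \<in> {0, 1, 2, 3} \<and> m = 4 \<and> e = 1"
    using assms by auto
  then show "(of_int ((a + b) mod m div 2) :: bit) =
      of_int (a div 2) + of_int (b div 2) + e * of_int a * of_int b"
    and "(of_int (a * b mod m div 2) :: bit) = of_int a * of_int (b div 2) + of_int (a div 2) * of_int b"
    by (elim disjE conjE insertE emptyE; simp add: bit_self_add)+
qed

lemma ring_residue_ring: "1 < m \<Longrightarrow> ring (residue_ring m)"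
  using residues.cring[of m] cring.axioms(1) by (auto simp: residues_def)

text \<open>The coefficients of a product at \<open>[U, U]\<close> and \<open>[U, V]\<close> contain
  \<open>f [U] g [U]\<close> and \<open>f [U] g [V]\<close>. Their sum supplies
  \<open>x x' + x y'\<close>, the product form with \<open>p = 1\<close> and
  \<open>q = 0\<close>.\<close>

lemma form_map_hom:
  assumes m: "m = 2 \<and> e = 0 \<or> m = 4 \<and> e = 1"
  shows "ring_hom_ring (free_algebra (residue_ring m)) (form_ring e 1 0) form_map"
proof -
  interpret A: ring "residue_ring m"
    using m by (intro ring_residue_ring) auto
  have "even m" using m by auto
  note mod = of_int_bit_mod[OF \<open>even m\<close>]
  show ?thesis
  proof (rule ring_hom_ringI[OF A.ring_free_algebra ring_form_ring])
    fix f g :: "gens list \<Rightarrow> int"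
    assume "f \<in> carrier (free_algebra (residue_ring m))" "g \<in> carrier (free_algebra (residue_ring m))"
    then have fg: "range f \<subseteq> carrier (residue_ring m)" "range g \<subseteq> carrier (residue_ring m)"
      by simp_all
    then have "range (\<lambda>w. f (x # w)) \<subseteq> carrier (residue_ring m)"
      "range (\<lambda>w. f (x # y # w)) \<subseteq> carrier (residue_ring m)" for x y
      by auto
    note mult = A.free_mult_Nil[OF fg] A.free_mult_Cons[OF fg]
      A.free_mult_Nil[OF this(1) fg(2)] A.free_mult_Cons[OF this(1) fg(2)]
      A.free_mult_Nil[OF this(2) fg(2)]
    have "f [] \<in> {0..m - 1}" "g [] \<in> {0..m - 1}"
      using subsetD[OF fg(1)] subsetD[OF fg(2)] by (simp_all only: residue_ring_simps(1) rangeI)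
    note digit = second_digit[OF m this]
    show "form_map (f \<otimes>\<^bsub>free_algebra (residue_ring m)\<^esub> g) =
        form_map f \<otimes>\<^bsub>form_ring e 1 0\<^esub> form_map g"
      by (simp add: form_map_def mult residue_ring_simps mod digit algebra_simps)
    show "form_map (f \<oplus>\<^bsub>free_algebra (residue_ring m)\<^esub> g) =
        form_map f \<oplus>\<^bsub>form_ring e 1 0\<^esub> form_map g"
      by (simp add: form_map_def residue_ring_simps mod digit algebra_simps)
  qed (simp_all add: form_map_def residue_ring_simps)
qed

lemma form_map_surj:
  assumes m: "m = 2 \<or> m = 4"
  shows "form_map ` carrier (free_algebra (residue_ring m)) = UNIV"
proof (intro equalityI subset_UNIV subsetI)
  fix a :: quad
  obtain t x y z where a: "a = (t, x, y, z)" by (cases a)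
  \<comment> \<open>Bits are lifted to 0 and 1, so the constant coefficient has second digit 0 and
    does not disturb the last coordinate.\<close>
  define i where "i b = (if b = 1 then 1 else 0 :: int)" for b :: bit
  have i: "of_int (i b) = b" "i b div 2 = 0" "i b \<in> {0..m - 1}" for b
    using m by (cases b; auto simp: i_def)+
  define f where "f w = (if w = [] then i t else if w = [U] then i x
    else if w = [V] then i y else if w = [U, V] then i z else 0)" for w
  have "finite {w. f w \<noteq> 0}"
    by (rule finite_subset[of _ "{[], [U], [V], [U, V]}"]) (auto simp: f_def)
  moreover have "f w \<in> {0..m - 1}" for w
    using i(3) m by (auto simp: f_def)
  ultimately have "f \<in> carrier (free_algebra (residue_ring m))"
    by (auto simp: residue_ring_simps)
  moreover have "form_map f = a"
    by (simp add: form_map_def f_def i a)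
  ultimately show "a \<in> form_map ` carrier (free_algebra (residue_ring m))"
    by blast
qed

text \<open>The generated ideal is the kernel of \<open>form_map\<close>, and the first isomorphism
  theorem applies. The last hypothesis quantifies over all ideals containing \<open>S\<close>, so
  that it can be checked by closure properties alone.\<close>

lemma quotient_iso_form_ring:
  fixes m P
  defines "P \<equiv> free_algebra (residue_ring m)"
  assumes m: "m = 2 \<and> e = 0 \<or> m = 4 \<and> e = 1"
    and S: "S \<subseteq> carrier P" "\<And>f. f \<in> S \<Longrightarrow> form_map f = (0, 0, 0, 0)"
    and I: "\<And>I f. ideal I P \<Longrightarrow> S \<subseteq> I \<Longrightarrow> f \<in> carrier P \<Longrightarrow> form_map f = (0, 0, 0, 0) \<Longrightarrow> f \<in> I"
  shows "P Quot Idl\<^bsub>P\<^esub> S \<simeq> form_ring e 1 0" "ring (P Quot Idl\<^bsub>P\<^esub> S)"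
proof -
  interpret ring_hom_ring P "form_ring e 1 0" form_map
    unfolding P_def by (rule form_map_hom[OF m])
  have ideal: "ideal (Idl\<^bsub>P\<^esub> S) P"
    by (rule R.genideal_ideal[OF S(1)])
  have "Idl\<^bsub>P\<^esub> S = a_kernel P (form_ring e 1 0) form_map"
  proof
    have "S \<subseteq> a_kernel P (form_ring e 1 0) form_map"
    proof
      fix f assume "f \<in> S"
      then show "f \<in> a_kernel P (form_ring e 1 0) form_map"
        unfolding a_kernel_def' using S(1) S(2)[of f] by (simp add: subsetD)
    qed
    then show "Idl\<^bsub>P\<^esub> S \<subseteq> a_kernel P (form_ring e 1 0) form_map"
      by (rule R.genideal_minimal[OF kernel_is_ideal])
    show "a_kernel P (form_ring e 1 0) form_map \<subseteq> Idl\<^bsub>P\<^esub> S"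
    proof
      fix f assume "f \<in> a_kernel P (form_ring e 1 0) form_map"
      then show "f \<in> Idl\<^bsub>P\<^esub> S"
        unfolding a_kernel_def' by (intro I[OF ideal R.genideal_self[OF S(1)]]) simp_all
    qed
  qed
  moreover have "form_map ` carrier P = carrier (form_ring e 1 0)"
    unfolding P_def using form_map_surj m by auto
  ultimately show "P Quot Idl\<^bsub>P\<^esub> S \<simeq> form_ring e 1 0"
    using FactRing_iso by simp
  show "ring (P Quot Idl\<^bsub>P\<^esub> S)"
    by (rule ideal.quotient_is_ring[OF ideal])
qed

lemma form_map_eq_zero:
  assumes m: "m = 2 \<or> m = 4" and f: "f \<in> carrier (free_algebra (residue_ring m))"
    and "form_map f = (0, 0, 0, 0)"
  shows "even (f [])" "even (f [U])" "even (f [V])" "even (f [] div 2 + f [U, U] + f [U, V])"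
proof -
  have "of_int k = (if even k then 0 else 1 :: bit)" for k
    by (auto elim!: evenE oddE)
  then show "even (f [])" "even (f [U])" "even (f [V])" "even (f [] div 2 + f [U, U] + f [U, V])"
    using assms(3) by (auto simp: form_map_def bit_self_add split: if_splits simp flip: of_int_add)
qed

context
  fixes m :: int and e :: bit and P :: "(gens list \<Rightarrow> int) ring" and u v
  assumes m: "m = 2 \<and> e = 0 \<or> m = 4 \<and> e = 1"
  defines "P \<equiv> free_algebra (residue_ring m)"
    and "u \<equiv> free_gen (residue_ring m) U" and "v \<equiv> free_gen (residue_ring m) V"
begin

interpretation A: ring "residue_ring m"
  using m by (intro ring_residue_ring) auto

interpretation ring_hom_ring P "form_ring e 1 0" form_map
  unfolding P_def by (rule form_map_hom[OF m])

lemma free_algebra_small_pow: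
  assumes "a \<in> carrier P"
  shows "a [^]\<^bsub>P\<^esub> (2::nat) = a \<otimes>\<^bsub>P\<^esub> a" "a [^]\<^bsub>P\<^esub> (3::nat) = a \<otimes>\<^bsub>P\<^esub> a \<otimes>\<^bsub>P\<^esub> a"
    "[(2::nat)] \<cdot>\<^bsub>P\<^esub> a = a \<oplus>\<^bsub>P\<^esub> a"
  using assms by (simp_all only: numeral_2_eq_2 numeral_3_eq_3 R.nat_pow_Suc R.nat_pow_0 R.l_one
      R.add.nat_pow_Suc R.add.nat_pow_0 R.l_zero)

lemma gens_closed: "u \<in> carrier P" "v \<in> carrier P"
  unfolding u_def v_def P_def by (rule A.free_gen_closed)+

lemma form_map_uv: "form_map u = (0, 1, 0, 0)" "form_map v = (0, 0, 1, 0)"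
  by (simp_all add: form_map_def free_gen_def residue_ring_simps u_def v_def)

lemma form_map_minus:
  assumes "a \<in> carrier P" "b \<in> carrier P" "form_map a = form_map b"
  shows "form_map (a \<ominus>\<^bsub>P\<^esub> b) = (0, 0, 0, 0)"
  using assms S.r_neg[of "form_map b"] by (simp add: R.minus_eq)

lemma form_map_relations:
  "form_map (u [^]\<^bsub>P\<^esub> (3::nat)) = (0, 0, 0, 0)"
  "form_map (v [^]\<^bsub>P\<^esub> (2::nat)) = (0, 0, 0, 0)"
  "form_map (v \<otimes>\<^bsub>P\<^esub> u) = (0, 0, 0, 0)"
  "form_map (u [^]\<^bsub>P\<^esub> (2::nat) \<ominus>\<^bsub>P\<^esub> u \<otimes>\<^bsub>P\<^esub> v) = (0, 0, 0, 0)"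
  "e = 1 \<Longrightarrow> form_map ([(2::nat)] \<cdot>\<^bsub>P\<^esub> \<one>\<^bsub>P\<^esub> \<ominus>\<^bsub>P\<^esub> u \<otimes>\<^bsub>P\<^esub> v) = (0, 0, 0, 0)"
  "form_map ([(2::nat)] \<cdot>\<^bsub>P\<^esub> u) = (0, 0, 0, 0)"
  "form_map ([(2::nat)] \<cdot>\<^bsub>P\<^esub> v) = (0, 0, 0, 0)"
proof -
  note [simp] = gens_closed form_map_uv free_algebra_small_pow bit_self_add
  have one: "form_map \<one>\<^bsub>P\<^esub> = (1, 0, 0, 0)"
    using hom_one by simp
  show "form_map (u [^]\<^bsub>P\<^esub> (2::nat) \<ominus>\<^bsub>P\<^esub> u \<otimes>\<^bsub>P\<^esub> v) = (0, 0, 0, 0)"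
    by (intro form_map_minus) simp_all
  show "e = 1 \<Longrightarrow> form_map ([(2::nat)] \<cdot>\<^bsub>P\<^esub> \<one>\<^bsub>P\<^esub> \<ominus>\<^bsub>P\<^esub> u \<otimes>\<^bsub>P\<^esub> v) = (0, 0, 0, 0)"
    by (intro form_map_minus) (simp_all add: one)
qed (simp_all add: gens_closed form_map_uv free_algebra_small_pow bit_self_add)

text \<open>In the normal form of a kernel element the coefficients of \<open>u\<close> and
  \<open>v\<close> are even, so these terms vanish or equal \<open>2 u\<close>, \<open>2 v\<close>.
  The constant and the term in \<open>u v\<close> must be treated together, because
  \<open>2 = u v\<close> links them.\<close>

lemma kernel_in_ideal:
  assumes I: "ideal I P" and f: "f \<in> carrier P" "form_map f = (0, 0, 0, 0)"
    and rels: "v [^]\<^bsub>P\<^esub> (2::nat) \<in> I" "v \<otimes>\<^bsub>P\<^esub> u \<in> I"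
      "u [^]\<^bsub>P\<^esub> (2::nat) \<ominus>\<^bsub>P\<^esub> u \<otimes>\<^bsub>P\<^esub> v \<in> I"
    and rels4: "m = 4 \<Longrightarrow> [(2::nat)] \<cdot>\<^bsub>P\<^esub> \<one>\<^bsub>P\<^esub> \<ominus>\<^bsub>P\<^esub> u \<otimes>\<^bsub>P\<^esub> v \<in> I"
      "m = 4 \<Longrightarrow> [(2::nat)] \<cdot>\<^bsub>P\<^esub> u \<in> I" "m = 4 \<Longrightarrow> [(2::nat)] \<cdot>\<^bsub>P\<^esub> v \<in> I"
  shows "f \<in> I"
proof -
  interpret I: ideal I P by fact
  note [simp] = gens_closed free_algebra_small_pow
  define K where "K = (free_const (residue_ring m) :: int \<Rightarrow> gens list \<Rightarrow> int)"
  define c where "c = (f [U, U] + f [U, V]) mod m"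
  obtain i where i: "i \<in> I" and f_eq: "f = K (f []) \<oplus>\<^bsub>P\<^esub> u \<otimes>\<^bsub>P\<^esub> K (f [U]) \<oplus>\<^bsub>P\<^esub>
      v \<otimes>\<^bsub>P\<^esub> K (f [V]) \<oplus>\<^bsub>P\<^esub> u \<otimes>\<^bsub>P\<^esub> v \<otimes>\<^bsub>P\<^esub> K c \<oplus>\<^bsub>P\<^esub> i"
    using A.free_algebra_normal_form[of I f, folded P_def u_def v_def] I f(1) rels
    by (auto simp: residue_ring_simps c_def K_def)
  have K_closed: "K k \<in> carrier P" if "k \<in> {0..m - 1}" for k
    using A.free_const_closed[of k] that unfolding P_def K_def residue_ring_simps by blast
  have coeff: "f w \<in> {0..m - 1}" for w
    using f(1) unfolding P_def by (auto simp: residue_ring_simps image_subset_iff)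
  have c: "c \<in> {0..m - 1}"
    using m by (auto simp: c_def)
  have "even m" using m by auto
  then have even: "even (f [])" "even (f [U])" "even (f [V])" "even (f [] div 2 + c)"
    using form_map_eq_zero[of m f] m f unfolding P_def c_def by (auto simp: dvd_mod_iff)
  have K0: "K 0 = \<zero>\<^bsub>P\<^esub>"
    by (simp add: K_def free_const_def P_def fun_eq_iff residue_ring_simps)
  have K1: "K 1 = \<one>\<^bsub>P\<^esub>"
    by (simp add: K_def free_const_def P_def fun_eq_iff residue_ring_simps)
  have K2: "K 2 = \<one>\<^bsub>P\<^esub> \<oplus>\<^bsub>P\<^esub> \<one>\<^bsub>P\<^esub>" if "m = 4"
    using that by (simp add: K_def free_const_def P_def fun_eq_iff residue_ring_simps)
  have K3: "K 3 = \<one>\<^bsub>P\<^esub> \<oplus>\<^bsub>P\<^esub> \<one>\<^bsub>P\<^esub> \<oplus>\<^bsub>P\<^esub> \<one>\<^bsub>P\<^esub>" if "m = 4"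
    using that by (simp add: K_def free_const_def P_def fun_eq_iff residue_ring_simps)
  have digits: "k = 0 \<or> m = 4 \<and> k = 2" if "even k" "k \<in> {0..m - 1}" for k
    using that m by auto
  have "u \<otimes>\<^bsub>P\<^esub> K (f [U]) \<in> I" "v \<otimes>\<^bsub>P\<^esub> K (f [V]) \<in> I"
    using digits[OF even(2) coeff] digits[OF even(3) coeff] rels4
    by (auto simp: K0 K2 R.r_distr)
  moreover have "K (f []) \<oplus>\<^bsub>P\<^esub> u \<otimes>\<^bsub>P\<^esub> v \<otimes>\<^bsub>P\<^esub> K c \<in> I"
  proof -
    have uv2: "u \<otimes>\<^bsub>P\<^esub> v \<oplus>\<^bsub>P\<^esub> u \<otimes>\<^bsub>P\<^esub> v \<in> I" if "m = 4"
      using I.I_r_closed[OF rels4(2), of v] that by (simp add: R.l_distr)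
    have odd: "c = 1 \<or> c = 3" if "odd c" "0 \<le> c" "c < 4"
      using that by presburger
    \<comment> \<open>For \<open>m = 4\<close> the parity of \<open>f [] div 2 + c\<close> ties
      \<open>c\<close> to the second digit of \<open>f []\<close>. The last two cases rest on
      \<open>2 + u v = (2 - u v) + 2 u v\<close> and
      \<open>2 + 3 u v = (2 - u v) + 4 u v\<close>.\<close>
    consider "f [] = 0" "c = 0" | "m = 4" "f [] = 0" "c = 2"
      | "m = 4" "f [] = 2" "c = 1" | "m = 4" "f [] = 2" "c = 3"
      using digits[OF even(1) coeff] even(4) c digits[of c] odd by auto
    then show ?thesis
    proof cases
      case 1
      then show ?thesis by (simp add: K0)
    next
      case 2
      then show ?thesis using uv2 by (simp add: K0 K2 R.r_distr)
    next
      case 3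
      have "K (f []) \<oplus>\<^bsub>P\<^esub> u \<otimes>\<^bsub>P\<^esub> v \<otimes>\<^bsub>P\<^esub> K c =
          ([(2::nat)] \<cdot>\<^bsub>P\<^esub> \<one>\<^bsub>P\<^esub> \<ominus>\<^bsub>P\<^esub> u \<otimes>\<^bsub>P\<^esub> v) \<oplus>\<^bsub>P\<^esub> (u \<otimes>\<^bsub>P\<^esub> v \<oplus>\<^bsub>P\<^esub> u \<otimes>\<^bsub>P\<^esub> v)"
        by (simp add: 3 K1 K2 R.minus_eq R.a_assoc R.r_neg1)
      then show ?thesis
        using I.a_closed[OF rels4(1) uv2] 3(1) by simp
    next
      case 4
      have "K (f []) \<oplus>\<^bsub>P\<^esub> u \<otimes>\<^bsub>P\<^esub> v \<otimes>\<^bsub>P\<^esub> K c =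
          ([(2::nat)] \<cdot>\<^bsub>P\<^esub> \<one>\<^bsub>P\<^esub> \<ominus>\<^bsub>P\<^esub> u \<otimes>\<^bsub>P\<^esub> v) \<oplus>\<^bsub>P\<^esub>
          (u \<otimes>\<^bsub>P\<^esub> v \<oplus>\<^bsub>P\<^esub> u \<otimes>\<^bsub>P\<^esub> v) \<oplus>\<^bsub>P\<^esub> (u \<otimes>\<^bsub>P\<^esub> v \<oplus>\<^bsub>P\<^esub> u \<otimes>\<^bsub>P\<^esub> v)"
        by (simp add: 4 K2 K3 R.minus_eq R.a_assoc R.r_neg1 R.r_distr)
      then show ?thesis
        using I.a_closed[OF I.a_closed[OF rels4(1) uv2] uv2] 4(1) by simp
    qed
  qed
  ultimately have "(K (f []) \<oplus>\<^bsub>P\<^esub> u \<otimes>\<^bsub>P\<^esub> v \<otimes>\<^bsub>P\<^esub> K c) \<oplus>\<^bsub>P\<^esub> u \<otimes>\<^bsub>P\<^esub> K (f [U]) \<oplus>\<^bsub>P\<^esub>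
      v \<otimes>\<^bsub>P\<^esub> K (f [V]) \<oplus>\<^bsub>P\<^esub> i \<in> I"
    using i by (simp add: I.a_closed)
  moreover have "f = (K (f []) \<oplus>\<^bsub>P\<^esub> u \<otimes>\<^bsub>P\<^esub> v \<otimes>\<^bsub>P\<^esub> K c) \<oplus>\<^bsub>P\<^esub> u \<otimes>\<^bsub>P\<^esub> K (f [U]) \<oplus>\<^bsub>P\<^esub>
      v \<otimes>\<^bsub>P\<^esub> K (f [V]) \<oplus>\<^bsub>P\<^esub> i"
    using K_closed[OF coeff] K_closed[OF c] I.Icarr[OF i] by (subst f_eq) (simp add: R.a_ac)
  ultimately show ?thesis by metis
qed

end

lemma ring_i_iso: "ring_i \<simeq> form_ring 0 1 0" "ring ring_i"
proof -
  have m: "(2::int) = 2 \<and> (0::bit) = 0 \<or> (2::int) = 4 \<and> (0::bit) = 1" by simp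
  let ?A = "residue_ring 2"
  let ?P = "free_algebra ?A :: (gens list \<Rightarrow> int) ring"
  interpret A: ring ?A by (rule ring_residue_ring) simp
  interpret P: ring ?P by (rule A.ring_free_algebra)
  note uv = A.free_gen_closed[of U] A.free_gen_closed[of V]
  show "ring_i \<simeq> form_ring 0 1 0" "ring ring_i"
    unfolding ring_i_def Let_def
    by (rule quotient_iso_form_ring[OF m],
        use uv in \<open>simp only: insert_subset empty_subsetI P.nat_pow_closed P.m_closed P.minus_closed\<close>,
        use form_map_relations[OF m] in blast,
        use kernel_in_ideal[OF m] in simp)+
qed

lemma ring_ii_iso: "ring_ii \<simeq> form_ring 1 1 0" "ring ring_ii"
proof -
  have m: "(4::int) = 2 \<and> (1::bit) = 0 \<or> (4::int) = 4 \<and> (1::bit) = 1" by simp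
  let ?A = "residue_ring 4"
  let ?P = "free_algebra ?A :: (gens list \<Rightarrow> int) ring"
  interpret A: ring ?A by (rule ring_residue_ring) simp
  interpret P: ring ?P by (rule A.ring_free_algebra)
  note uv = A.free_gen_closed[of U] A.free_gen_closed[of V]
  show "ring_ii \<simeq> form_ring 1 1 0" "ring ring_ii"
    unfolding ring_ii_def Let_def
    by (rule quotient_iso_form_ring[OF m],
        use uv in \<open>simp only: insert_subset empty_subsetI P.nat_pow_closed P.m_closed P.minus_closed
          P.add.nat_pow_closed P.one_closed\<close>,
        use form_map_relations[OF m] in blast,
        use kernel_in_ideal[OF m] in simp)+
qed

theorem theorem3p2:
  shows "(\<forall>R :: ('a, 'm) ring_scheme.
            nonreflexive_semicommutative_nonduo R \<and> finite (carrier R) \<longrightarrow> 16 \<le> order R) \<and>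
         (nonreflexive_semicommutative_nonduo ring_i \<and> order ring_i = 16) \<and>
         (nonreflexive_semicommutative_nonduo ring_ii \<and> order ring_ii = 16) \<and>
         \<not> ring_i \<simeq> ring_ii \<and>
         (\<forall>R :: ('a, 'm) ring_scheme.
            nonreflexive_semicommutative_nonduo R \<and> order R = 16 \<longrightarrow>
              R \<simeq> ring_i \<or> R \<simeq> ring_ii)"
proof (intro conjI allI impI)
  have form: "nonreflexive_semicommutative_nonduo S \<and> order S = 16"
    if "S \<simeq> form_ring e 1 0" "ring S" for S :: "(gens list \<Rightarrow> int) set ring" and e
    using that iso_order[OF that(1)] card_quad ring_iso_sym[OF that(2,1)]
      iso_nonreflexive_semicommutative_nonduo[OF _ ring_form_ring that(2)
        form_ring_nonreflexive_semicommutative_nonduo]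
    by (simp add: order_def)
  show "nonreflexive_semicommutative_nonduo ring_i" "order ring_i = 16"
    "nonreflexive_semicommutative_nonduo ring_ii" "order ring_ii = 16"
    using form[OF ring_i_iso] form[OF ring_ii_iso] by simp_all
  show "\<not> ring_i \<simeq> ring_ii"
    using form_ring_not_iso ring_iso_trans ring_iso_sym ring_i_iso ring_ii_iso by metis
next
  fix R :: "('a, 'm) ring_scheme"
  \<comment> \<open>Finiteness is a separate assumption here because \<open>order\<close> is 0 for
    an infinite carrier; for the same reason order 16 entails finiteness in the
    classification.\<close>
  assume R: "nonreflexive_semicommutative_nonduo R \<and> finite (carrier R)"
  then interpret ring R
    by (simp add: nonreflexive_semicommutative_nonduo_def)
  obtain u v where uv: "skew_pair R u v"
    using R finite_nonreflexive_semicommutative_skew_pair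
    by (auto simp: nonreflexive_semicommutative_nonduo_def)
  show "16 \<le> order R"
    using skew_pair.order_ge[OF uv] R by simp
next
  fix R :: "('a, 'm) ring_scheme"
  assume R: "nonreflexive_semicommutative_nonduo R \<and> order R = 16"
  then interpret ring R
    by (simp add: nonreflexive_semicommutative_nonduo_def)
  have "finite (carrier R)"
    using R by (auto simp: order_def intro: card_ge_0_finite)
  then obtain u v where uv: "skew_pair R u v"
    using R finite_nonreflexive_semicommutative_skew_pair
    by (auto simp: nonreflexive_semicommutative_nonduo_def)
  obtain e where e: "R \<simeq> form_ring e 1 0"
    using R skew_pair.iso_form_ring_1_0[OF uv]
    by (auto simp: nonreflexive_semicommutative_nonduo_def)
  show "R \<simeq> ring_i \<or> R \<simeq> ring_ii"
  proof (cases "e = 0")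
    case True
    then show ?thesis
      using e ring_iso_trans ring_iso_sym[OF ring_i_iso(2,1)] by blast
  next
    case False
    then show ?thesis
      using e ring_iso_trans ring_iso_sym[OF ring_ii_iso(2,1)] by auto
  qed
qed

end
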